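(* Let $M$ be a non-uniform matroid of rank $k$ on a ground set $E$ of size $n$ such that the dual matroid $M^*$ is paving. If $n \ge 2k$, then $$\widehat{\rho}(I(M))=\frac{\alpha(I(M))}{\widehat{\alpha}(I(M))}=\frac{k}{\widehat{\alpha}(I(M))}.$$
   Context: Let $\mathbb{K}$ be a field, $S=\mathbb{K}[x_e : e\in E]$ the standard graded polynomial ring, and $x^U=\prod_{i\in U}x_i$ for $U\subseteq E$. For a squarefree monomial ideal $I\subseteq S$ and $s\ge 1$, the $s$-th symbolic power is $I^{(s)}=\bigcap_{P\in \mathrm{Min}(I)}P^s$, where $\mathrm{Min}(I)$ is the set of minimal primes of $I$. For a nonzero homogeneous ideal $I$, $\alpha(I)$ is the smallest degree of a nonzero homogeneous element of $I$; the Waldschmidt constant is $\widehat{\alpha}(I)=\lim_{s\to\infty}\alpha(I^{(s)})/s$. The asymptotic resurgence is $\widehat{\rho}(I)=\sup\{ s/r : s,r \text{ positive integers and } I^{(st)}\not\subseteq I^{rt}\text{ for all } t\gg 0\}$. For a matroid $M$ on $E$ with set of bases $\mathcal{B}(M)$, the facet ideal is $I(M)=\langle x^B : B\in\mathcal{B}(M)\rangle$. The dual matroid $M^*$ has bases $\{E\setminus B : B\in\mathcal{B}(M)\}$. The uniform matroid of rank $k$ on $E$ has as bases all $k$-element subsets of $E$; $M$ is non-uniform if it is not of this form. A matroid of rank $r$ is paving if every circuit has size at least $r$. *)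

theory Defs
  imports
    Complex_Main
    "HOL-Library.Poly_Mapping"
    "HOL-Library.Extended_Real"
    "HOL-Algebra.Ideal_Product"
begin

section \<open>Matroids\<close>

definition matroid :: "'e set \<Rightarrow> 'e set set \<Rightarrow> bool" where
  "matroid E \<B> \<longleftrightarrow>
     finite E \<and> \<B> \<noteq> {} \<and> (\<forall>B\<in>\<B>. B \<subseteq> E) \<and>
     (\<forall>A\<in>\<B>. \<forall>B\<in>\<B>. \<forall>a\<in>A - B. \<exists>b\<in>B - A. insert b (A - {a}) \<in> \<B>)"

text \<open>The rank is the common cardinality of all bases; see \<open>card_basis\<close> below.\<close>

definition matroid_rank :: "'e set set \<Rightarrow> nat" where
  "matroid_rank \<B> = (THE r. \<forall>B\<in>\<B>. card B = r)"

definition dual_bases :: "'e set \<Rightarrow> 'e set set \<Rightarrow> 'e set set" where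
  "dual_bases E \<B> = (\<lambda>B. E - B) ` \<B>"

definition indep :: "'e set set \<Rightarrow> 'e set \<Rightarrow> bool" where
  "indep \<B> X \<longleftrightarrow> (\<exists>B\<in>\<B>. X \<subseteq> B)"

definition circuit :: "'e set \<Rightarrow> 'e set set \<Rightarrow> 'e set \<Rightarrow> bool" where
  "circuit E \<B> C \<longleftrightarrow> C \<subseteq> E \<and> \<not> indep \<B> C \<and> (\<forall>X. X \<subset> C \<longrightarrow> indep \<B> X)"

definition paving :: "'e set \<Rightarrow> 'e set set \<Rightarrow> bool" where
  "paving E \<B> \<longleftrightarrow> (\<forall>C. circuit E \<B> C \<longrightarrow> matroid_rank \<B> \<le> card C)"

definition uniform :: "'e set \<Rightarrow> 'e set set \<Rightarrow> bool" where
  "uniform E \<B> \<longleftrightarrow> (\<exists>k. \<B> = {B. B \<subseteq> E \<and> card B = k})"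

lemma matroid_card_le:
  assumes M: "matroid E \<B>" and "A \<in> \<B>" "B \<in> \<B>"
  shows "card A \<le> card B"
  using assms(2)
proof (induction "card (A - B)" arbitrary: A rule: less_induct)
  case less
  have "finite E" and sub: "\<And>X. X \<in> \<B> \<Longrightarrow> X \<subseteq> E"
    and exch: "\<And>X Y x. X \<in> \<B> \<Longrightarrow> Y \<in> \<B> \<Longrightarrow> x \<in> X - Y \<Longrightarrow>
      \<exists>y\<in>Y - X. insert y (X - {x}) \<in> \<B>"
    using M by (simp_all add: matroid_def)
  then have fA: "finite A" and fB: "finite B"
    using sub[OF less.prems] sub[OF assms(3)] by (auto intro: finite_subset)
  show ?case
  proof (cases "A \<subseteq> B")
    case True
    then show ?thesis using fB card_mono by blast
  next
    case False
    then obtain a where a: "a \<in> A - B" by blast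
    obtain b where b: "b \<in> B - A" and A': "insert b (A - {a}) \<in> \<B>"
      using exch[OF less.prems assms(3) a] by (elim bexE)
    have "insert b (A - {a}) - B = (A - B) - {a}" using b by auto
    then have "card (insert b (A - {a}) - B) < card (A - B)"
      using a fA by (simp only: card_Diff1_less finite_Diff)
    then have "card (insert b (A - {a})) \<le> card B" using A' by (rule less.hyps)
    moreover have "card (insert b (A - {a})) = card A"
      using a b fA card_Suc_Diff1[of A a] by simp
    ultimately show ?thesis by simp
  qed
qed

lemma card_basis:
  assumes "matroid E \<B>" and "B \<in> \<B>"
  shows "card B = matroid_rank \<B>"
proof -
  have eq: "card A = card B" if "A \<in> \<B>" for A
    using matroid_card_le[OF assms(1)] assms(2) that by (meson le_antisym)
  have "matroid_rank \<B> = card B"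
    unfolding matroid_rank_def
  proof (rule the_equality)
    show "\<forall>A\<in>\<B>. card A = card B" using eq by blast
    show "r = card B" if "\<forall>A\<in>\<B>. card A = r" for r
      using bspec[OF that assms(2)] by (rule sym)
  qed
  then show ?thesis by simp
qed


section \<open>The polynomial ring with variables indexed by a set\<close>

type_synonym ('e, 'k) mpoly = "('e \<Rightarrow>\<^sub>0 nat) \<Rightarrow>\<^sub>0 'k"

text \<open>Exponent vectors are finitely supported maps \<open>'e \<Rightarrow>\<^sub>0 nat\<close>, and a polynomial maps exponent
  vectors to coefficients; only variables with index in \<open>E\<close> may occur.\<close>

definition mpoly_ring :: "'e set \<Rightarrow> ('e, 'k::field) mpoly ring" where
  "mpoly_ring E =
     \<lparr>carrier = {p. \<forall>m\<in>Poly_Mapping.keys p. Poly_Mapping.keys m \<subseteq> E},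
      monoid.mult = (*), one = 1, zero = 0, add = (+)\<rparr>"

definition mpoly_var :: "'e \<Rightarrow> ('e, 'k::field) mpoly" where
  "mpoly_var e = Poly_Mapping.single (Poly_Mapping.single e 1) 1"

definition exp_degree :: "('e \<Rightarrow>\<^sub>0 nat) \<Rightarrow> nat" where
  "exp_degree m = (\<Sum>e\<in>Poly_Mapping.keys m. Poly_Mapping.lookup m e)"

definition homogeneous :: "nat \<Rightarrow> ('e, 'k::field) mpoly \<Rightarrow> bool" where
  "homogeneous d p \<longleftrightarrow> (\<forall>m\<in>Poly_Mapping.keys p. exp_degree m = d)"

lemma mpoly_ring_add_closed:
  fixes p q :: "('e, 'k::field) mpoly"
  assumes "p \<in> carrier (mpoly_ring E)" and "q \<in> carrier (mpoly_ring E)"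
  shows "p + q \<in> carrier (mpoly_ring E)"
  using assms Poly_Mapping.keys_add[of p q] unfolding mpoly_ring_def by force

lemma mpoly_ring_mult_closed:
  fixes p q :: "('e, 'k::field) mpoly"
  assumes "p \<in> carrier (mpoly_ring E)" and "q \<in> carrier (mpoly_ring E)"
  shows "p * q \<in> carrier (mpoly_ring E)"
proof -
  have "Poly_Mapping.keys m \<subseteq> E" if "m \<in> Poly_Mapping.keys (p * q)" for m
  proof -
    from that obtain a b where "a \<in> Poly_Mapping.keys p" "b \<in> Poly_Mapping.keys q" "m = a + b"
      using keys_mult[of p q] by blast
    then show ?thesis
      using assms Poly_Mapping.keys_add[of a b] unfolding mpoly_ring_def by fastforce
  qed
  then show ?thesis by (simp add: mpoly_ring_def)
qed

lemma mpoly_ring_ops [simp]: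
  "x \<oplus>\<^bsub>mpoly_ring E\<^esub> y = x + y"
  "x \<otimes>\<^bsub>mpoly_ring E\<^esub> y = x * y"
  "\<zero>\<^bsub>mpoly_ring E\<^esub> = 0"
  "\<one>\<^bsub>mpoly_ring E\<^esub> = 1"
  by (simp_all add: mpoly_ring_def)

lemma cring_mpoly_ring: "cring (mpoly_ring E :: ('e, 'k::field) mpoly ring)"
proof (rule cringI)
  show "abelian_group (mpoly_ring E :: ('e, 'k) mpoly ring)"
  proof (rule abelian_groupI)
    fix x :: "('e, 'k) mpoly" assume "x \<in> carrier (mpoly_ring E)"
    then have "- x \<in> carrier (mpoly_ring E)" by (simp add: mpoly_ring_def)
    then show "\<exists>y\<in>carrier (mpoly_ring E). y \<oplus>\<^bsub>mpoly_ring E\<^esub> x = \<zero>\<^bsub>mpoly_ring E\<^esub>"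
      by (intro bexI[of _ "- x"]) simp_all
  next
    show "\<zero>\<^bsub>mpoly_ring E\<^esub> \<in> carrier (mpoly_ring E :: ('e, 'k) mpoly ring)"
      by (simp add: mpoly_ring_def)
  qed (simp_all add: mpoly_ring_add_closed add.assoc add.commute)
  show "comm_monoid (mpoly_ring E :: ('e, 'k) mpoly ring)"
  proof (rule comm_monoidI)
    show "\<one>\<^bsub>mpoly_ring E\<^esub> \<in> carrier (mpoly_ring E :: ('e, 'k) mpoly ring)"
      by (simp add: mpoly_ring_def)
  qed (simp_all add: mpoly_ring_mult_closed mult.assoc mult.commute)
qed (simp add: distrib_right)


section \<open>Powers, symbolic powers and asymptotic invariants of ideals\<close>

primrec ideal_power :: "('a, 'b) ring_scheme \<Rightarrow> 'a set \<Rightarrow> nat \<Rightarrow> 'a set" where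
  "ideal_power R I 0 = carrier R"
| "ideal_power R I (Suc s) = ideal_prod R (ideal_power R I s) I"

definition minimal_primes :: "('a, 'b) ring_scheme \<Rightarrow> 'a set \<Rightarrow> 'a set set" where
  "minimal_primes R I =
     {P. primeideal P R \<and> I \<subseteq> P \<and> (\<forall>Q. primeideal Q R \<and> I \<subseteq> Q \<and> Q \<subseteq> P \<longrightarrow> Q = P)}"

text \<open>Intersecting with the carrier only matters for the unit ideal, which has no minimal primes.
  The definition is the usual one for radical ideals, such as squarefree monomial ideals.\<close>

definition symbolic_power :: "('a, 'b) ring_scheme \<Rightarrow> 'a set \<Rightarrow> nat \<Rightarrow> 'a set" where
  "symbolic_power R I s = carrier R \<inter> (\<Inter>P\<in>minimal_primes R I. ideal_power R P s)"

definition initial_degree :: "('e, 'k::field) mpoly set \<Rightarrow> nat" where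
  "initial_degree I = (LEAST d. \<exists>p\<in>I. p \<noteq> 0 \<and> homogeneous d p)"

definition waldschmidt :: "('e, 'k::field) mpoly ring \<Rightarrow> ('e, 'k) mpoly set \<Rightarrow> real" where
  "waldschmidt S I = lim (\<lambda>s. real (initial_degree (symbolic_power S I s)) / real s)"

text \<open>The supremum is taken in the extended reals, where it is meaningful without any boundedness
  or nonemptiness side condition.\<close>

definition asymptotic_resurgence :: "('a, 'b) ring_scheme \<Rightarrow> 'a set \<Rightarrow> ereal" where
  "asymptotic_resurgence R I =
     Sup {ereal (real s / real r) | s r :: nat.
       0 < s \<and> 0 < r \<and>
       (\<forall>\<^sub>F t in sequentially. \<not> symbolic_power R I (s * t) \<subseteq> ideal_power R I (r * t))}"


section \<open>Facet ideals\<close>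

text \<open>The coefficient field is passed as a type argument.\<close>

definition facet_ideal ::
    "'k::field itself \<Rightarrow> 'e set \<Rightarrow> 'e set set \<Rightarrow> ('e, 'k) mpoly set" where
  "facet_ideal K E \<B> = genideal (mpoly_ring E) ((\<lambda>B. \<Prod>e\<in>B. mpoly_var e) ` \<B>)"

end

theory Submission
  imports Defs
begin

text \<open>
  The minimal primes of \<open>I = I(M)\<close> are generated by the minimal transversals of the bases, that is, by the
  circuits of \<open>M\<^sup>*\<close>. Hence \<open>x\<^sup>m \<in> I\<^sup>(\<^sup>s\<^sup>)\<close> iff \<open>m(C) \<ge> s\<close> for all transversals \<open>C\<close>, and the Waldschmidt constant is
  the minimum \<open>\<tau>\<close> of \<open>x(E)\<close> over the fractional covers \<open>x \<ge> 0\<close>, those with \<open>x(C) \<ge> 1\<close> for all \<open>C\<close>.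
  By Edmonds' covering theorem for \<open>M\<^sup>*\<close>, \<open>x\<^sup>m \<in> I\<^sup>N\<close> iff \<open>m(A) \<ge> N g(A)\<close> for all \<open>A \<subseteq> E\<close>, where
  \<open>g(A)\<close> is the minimum of \<open>card (A \<inter> B)\<close> over the bases \<open>B\<close>. The condition for \<open>A = E\<close> yields the
  lower bound \<open>k / \<tau>\<close> for the asymptotic resurgence. It is also an upper bound as soon as every fractional cover \<open>x\<close>
  and every \<open>A\<close> satisfy \<open>g(A) \<tau> \<le> k x(A)\<close>. For this, \<open>x\<close> restricted to \<open>A\<close> is traded for a
  fractional cover \<open>y\<close> with \<open>g(A) y(E) \<le> k x(A)\<close>, which is where \<open>M\<^sup>*\<close> being paving of rank
  \<open>n - k \<ge> k\<close> enters.
\<close>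

section \<open>Matroid rank and duality\<close>

text \<open>Membership in the \<open>r\<close>-th ordinary power is one inequality for every
  \<open>A\<close>, while degrees see only the one for \<open>A = E\<close>. The obstacle is to show
  that for exponents from a symbolic power no smaller \<open>A\<close> is more restrictive. As
  \<tau> is a lower bound for all covers, \<open>y\<close> may be chosen separately for each
  \<open>A\<close>; it only has to be paid for by \<open>x\<close> on \<open>A\<close>.

  Put \<open>d = n - k\<close>. Paving leaves little freedom: every subset of \<open>E\<close> with
  at least \<open>d + 1\<close> elements is a transversal, none with fewer than \<open>d\<close>
  elements is, and only the \<open>d\<close>-sets vary. So if \<open>card A = d + j\<close>, then
  \<open>g(A)\<close> is \<open>j + 1\<close> when all \<open>d\<close>-subsets of \<open>A\<close>
  are transversals, and \<open>j\<close> otherwise. In the first case the constant cover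
  \<open>1 / d\<close> is cheap enough. In the second, \<open>x\<close> is kept on \<open>A\<close>
  and extended by a constant; since \<open>E - A\<close> has \<open>k - j\<close> elements, the
  value \<open>x(A) / j\<close> is the one that gives \<open>j y(E) = k x(A)\<close> exactly. If
  this extension is not a cover, then \<open>x(A)\<close> is so large that \<open>1 / d\<close>
  works again. These numerical comparisons use \<open>k \<le> d\<close>, that is,
  \<open>n \<ge> 2k\<close>.\<close>

lemma matroid_finite: "matroid E \<B> \<Longrightarrow> finite E"
  by (simp add: matroid_def)

lemma basis_subset: "matroid E \<B> \<Longrightarrow> B \<in> \<B> \<Longrightarrow> B \<subseteq> E"
  by (simp add: matroid_def)

lemma basis_finite: "matroid E \<B> \<Longrightarrow> B \<in> \<B> \<Longrightarrow> finite B"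
  using basis_subset matroid_finite finite_subset by metis

lemma finite_bases: "matroid E \<B> \<Longrightarrow> finite \<B>"
  by (rule finite_subset[of \<B> "Pow E"]) (auto simp: matroid_def)

lemma basis_exchange:
  assumes "matroid E \<B>" "A \<in> \<B>" "B \<in> \<B>" "a \<in> A - B"
  obtains b where "b \<in> B - A" "insert b (A - {a}) \<in> \<B>"
  using assms unfolding matroid_def by blast

lemma indep_subset_ground: "matroid E \<B> \<Longrightarrow> indep \<B> X \<Longrightarrow> X \<subseteq> E"
  unfolding indep_def using basis_subset by fast

lemma indep_finite: "matroid E \<B> \<Longrightarrow> indep \<B> X \<Longrightarrow> finite X"
  using indep_subset_ground matroid_finite finite_subset by metis

lemma indep_subset: "indep \<B> Y \<Longrightarrow> X \<subseteq> Y \<Longrightarrow> indep \<B> X"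
  unfolding indep_def by (meson subset_trans)

text \<open>Choose \<open>B2\<close> above \<open>Y\<close> with as few elements as possible outside
  \<open>Y\<close> and \<open>B1\<close>; an exchange shows that there are none. If nothing augments
  \<open>X\<close>, a second exchange puts \<open>B1\<close> inside the union of \<open>X\<close>
  and \<open>B2\<close>. Then \<open>card (Y - X) \<le> card (B2 - B1) = card (B1 - B2) \<le> card
  (X - Y)\<close>, against the assumption.\<close>

lemma indep_augment:
  assumes M: "matroid E \<B>" and X: "indep \<B> X" and Y: "indep \<B> Y" and less: "card X < card Y"
  shows "\<exists>y\<in>Y - X. indep \<B> (insert y X)"
proof (rule ccontr)
  assume no: "\<not> ?thesis"
  obtain B1 where B1: "B1 \<in> \<B>" "X \<subseteq> B1" using X unfolding indep_def by blast
  define m where "m = (\<lambda>B. card (B - (Y \<union> B1)))"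
  obtain B2 where B2: "B2 \<in> \<B>" "Y \<subseteq> B2" and min: "\<And>B. B \<in> \<B> \<Longrightarrow> Y \<subseteq> B \<Longrightarrow> m B2 \<le> m B"
    using ex_has_least_nat[of "\<lambda>B. B \<in> \<B> \<and> Y \<subseteq> B" _ m] Y unfolding indep_def by metis
  note fin = basis_finite[OF M B1(1)] basis_finite[OF M B2(1)]
  have 1: "B2 - (Y \<union> B1) = {}"
  proof (rule ccontr)
    assume "B2 - (Y \<union> B1) \<noteq> {}"
    then obtain x where x: "x \<in> B2" "x \<notin> Y" "x \<notin> B1" by blast
    obtain y where y: "y \<in> B1 - B2" "insert y (B2 - {x}) \<in> \<B>"
      using basis_exchange[OF M B2(1) B1(1)] x by blast
    have "m (insert y (B2 - {x})) < m B2" unfolding m_def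
      by (rule psubset_card_mono) (use x y fin in auto)
    then show False using min[OF y(2)] B2(2) x by fastforce
  qed
  have 2: "B1 - (X \<union> B2) = {}"
  proof (rule ccontr)
    assume "B1 - (X \<union> B2) \<noteq> {}"
    then obtain x where x: "x \<in> B1" "x \<notin> X" "x \<notin> B2" by blast
    obtain y where y: "y \<in> B2 - B1" "insert y (B1 - {x}) \<in> \<B>"
      using basis_exchange[OF M B1(1) B2(1)] x by blast
    have "y \<in> Y - X" using y(1) 1 B1(2) by blast
    moreover have "indep \<B> (insert y X)"
      unfolding indep_def using y(2) B1(2) x by (intro bexI[of _ "insert y (B1 - {x})"]) auto
    ultimately show False using no by blast
  qed
  have "Y \<inter> B1 \<subseteq> X"
  proof
    fix y assume "y \<in> Y \<inter> B1"
    then have "indep \<B> (insert y X)" unfolding indep_def using B1 by blast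
    then show "y \<in> X" using no \<open>y \<in> Y \<inter> B1\<close> by blast
  qed
  then have 3: "Y - X \<subseteq> B2 - B1" using B2(2) by blast
  have 4: "B1 - B2 \<subseteq> X - Y" using 2 B2(2) by blast
  have fX: "finite X" and fY: "finite Y" using fin B1(2) B2(2) finite_subset by blast+
  have "card B1 = card B2" using card_basis[OF M] B1(1) B2(1) by metis
  then have "card (B2 - B1) = card (B1 - B2)"
    using fin by (metis card_Diff_subset_Int card_Int_Diff Int_commute finite_Int)
  moreover have "card (Y - X) \<le> card (B2 - B1)" by (rule card_mono) (use fin 3 in auto)
  moreover have "card (B1 - B2) \<le> card (X - Y)" by (rule card_mono) (use fX 4 in auto)
  moreover have "card Y = card (Y \<inter> X) + card (Y - X)" by (rule card_Int_Diff[OF fY])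
  moreover have "card X = card (X \<inter> Y) + card (X - Y)" by (rule card_Int_Diff[OF fX])
  ultimately show False using less by (simp add: Int_commute)
qed

text \<open>Taken in the dual matroid, this maximum is \<open>card A - g(A)\<close> for
  \<open>A \<subseteq> E\<close>, which is how covering by dual independent sets turns into packing
  of bases.\<close>

definition rank_fun :: "'e set set \<Rightarrow> 'e set \<Rightarrow> nat" where
  "rank_fun \<B> A = Max ((\<lambda>B. card (A \<inter> B)) ` \<B>)"

lemma rank_fun_ge:
  assumes "matroid E \<B>" "B \<in> \<B>"
  shows "card (A \<inter> B) \<le> rank_fun \<B> A"
  unfolding rank_fun_def by (rule Max_ge) (use assms finite_bases in auto)

lemma rank_fun_attained:
  assumes "matroid E \<B>"
  obtains B where "B \<in> \<B>" "rank_fun \<B> A = card (A \<inter> B)"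
proof -
  have "rank_fun \<B> A \<in> (\<lambda>B. card (A \<inter> B)) ` \<B>"
    unfolding rank_fun_def
    by (rule Max_in) (use finite_bases[OF assms] assms in \<open>auto simp: matroid_def\<close>)
  then show ?thesis using that by blast
qed

lemma card_indep_le_rank:
  assumes M: "matroid E \<B>" and Z: "indep \<B> Z" "Z \<subseteq> A"
  shows "card Z \<le> rank_fun \<B> A"
proof -
  obtain B where B: "B \<in> \<B>" "Z \<subseteq> B" using Z unfolding indep_def by blast
  have "card Z \<le> card (A \<inter> B)"
    by (rule card_mono) (use basis_finite[OF M B(1)] B Z in auto)
  then show ?thesis using rank_fun_ge[OF M B(1), of A] by linarith
qed

lemma rank_fun_le_card:
  assumes "matroid E \<B>" "finite A"
  shows "rank_fun \<B> A \<le> card A"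
  using rank_fun_attained[OF assms(1), of A] assms(2) by (metis card_mono inf_le1)

lemma rank_fun_mono:
  assumes "matroid E \<B>" "A \<subseteq> A'"
  shows "rank_fun \<B> A \<le> rank_fun \<B> A'"
proof -
  obtain B where B: "B \<in> \<B>" "rank_fun \<B> A = card (A \<inter> B)" using rank_fun_attained[OF assms(1)] .
  have "card (A \<inter> B) \<le> card (A' \<inter> B)"
    by (rule card_mono) (use basis_finite[OF assms(1) B(1)] assms(2) in auto)
  then show ?thesis using rank_fun_ge[OF assms(1) B(1), of A'] B(2) by linarith
qed

lemma indep_iff_rank:
  assumes M: "matroid E \<B>" and "finite A"
  shows "indep \<B> A \<longleftrightarrow> rank_fun \<B> A = card A"
proof
  assume "indep \<B> A"
  then show "rank_fun \<B> A = card A"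
    using card_indep_le_rank[OF M, of A A] rank_fun_le_card[OF M assms(2)] by simp
next
  assume r: "rank_fun \<B> A = card A"
  obtain B where B: "B \<in> \<B>" "rank_fun \<B> A = card (A \<inter> B)" using rank_fun_attained[OF M] .
  then have "A \<inter> B = A" using r assms(2) by (intro card_subset_eq) auto
  then show "indep \<B> A" unfolding indep_def using B(1) by blast
qed

lemma indep_extend:
  assumes M: "matroid E \<B>" and X: "indep \<B> X" "X \<subseteq> A"
  obtains Z where "X \<subseteq> Z" "Z \<subseteq> A" "indep \<B> Z" "card Z = rank_fun \<B> A"
proof -
  define P where "P = (\<lambda>Z. X \<subseteq> Z \<and> Z \<subseteq> A \<and> indep \<B> Z)"
  have PX: "P X" unfolding P_def using X by blast
  have bd: "\<forall>Z. P Z \<longrightarrow> card Z < Suc (rank_fun \<B> A)"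
    unfolding P_def using card_indep_le_rank[OF M] less_Suc_eq_le by blast
  obtain Z where Z: "P Z" "\<And>Z'. P Z' \<Longrightarrow> card Z' \<le> card Z"
    using ex_has_greatest_nat[OF PX bd] by blast
  have "\<not> card Z < rank_fun \<B> A"
  proof
    assume less: "card Z < rank_fun \<B> A"
    obtain B where B: "B \<in> \<B>" "rank_fun \<B> A = card (A \<inter> B)" using rank_fun_attained[OF M] .
    have "indep \<B> (A \<inter> B)" unfolding indep_def using B(1) by blast
    then obtain y where y: "y \<in> A \<inter> B - Z" "indep \<B> (insert y Z)"
      using indep_augment[OF M, of Z "A \<inter> B"] Z(1) less B(2) unfolding P_def by auto
    have "finite Z" using Z(1) indep_finite[OF M] unfolding P_def by metis
    moreover have "P (insert y Z)" using Z(1) y unfolding P_def by blast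
    ultimately show False using Z(2)[of "insert y Z"] y by simp
  qed
  then have "card Z = rank_fun \<B> A" using bd[rule_format, OF Z(1)] by linarith
  then show ?thesis using that Z(1) unfolding P_def by blast
qed

text \<open>A largest independent subset of the intersection is extended to one of the union,
  \<open>Z\<close>; then the parts of \<open>Z\<close> in \<open>A\<close> and in \<open>A'\<close>
  are counted.\<close>

lemma rank_fun_submodular:
  assumes M: "matroid E \<B>"
  shows "rank_fun \<B> (A \<union> A') + rank_fun \<B> (A \<inter> A') \<le> rank_fun \<B> A + rank_fun \<B> A'"
proof -
  have "indep \<B> {}" using M unfolding matroid_def indep_def by blast
  then obtain X where X: "{} \<subseteq> X" "X \<subseteq> A \<inter> A'" "indep \<B> X" "card X = rank_fun \<B> (A \<inter> A')"
    by (rule indep_extend[OF M _ empty_subsetI])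
  have "X \<subseteq> A \<union> A'" using X(2) by auto
  then obtain Z where Z: "X \<subseteq> Z" "Z \<subseteq> A \<union> A'" "indep \<B> Z" "card Z = rank_fun \<B> (A \<union> A')"
    by (rule indep_extend[OF M X(3)])
  have fin: "finite Z" by (rule indep_finite[OF M Z(3)])
  have "card Z + card (Z \<inter> A \<inter> A') = card (Z \<inter> A) + card (Z \<inter> A')"
  proof -
    have "Z = (Z \<inter> A) \<union> (Z \<inter> A')" "Z \<inter> A \<inter> A' = (Z \<inter> A) \<inter> (Z \<inter> A')" using Z(2) by blast+
    then show ?thesis using card_Un_Int[of "Z \<inter> A" "Z \<inter> A'"] fin by simp
  qed
  moreover have "card X \<le> card (Z \<inter> A \<inter> A')"
    by (rule card_mono) (use fin X(2) Z(1) in auto)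
  moreover have "card (Z \<inter> A) \<le> rank_fun \<B> A" "card (Z \<inter> A') \<le> rank_fun \<B> A'"
    using card_indep_le_rank[OF M] indep_subset[OF Z(3)] by auto
  ultimately show ?thesis using X(4) Z(4) by linarith
qed

text \<open>Dual exchange asks for a basis \<open>A - {y}\<close> plus \<open>a\<close> in which the
  incoming \<open>a \<in> B - A\<close> is prescribed, whereas the axiom prescribes the outgoing
  element. Extending \<open>insert a (A \<inter> B)\<close> inside \<open>insert a A\<close> gives a
  basis that omits exactly one \<open>y\<close> of \<open>A\<close>, and \<open>y \<notin> B\<close>
  because \<open>A \<inter> B\<close> was kept.\<close>

lemma matroid_dual:
  assumes M: "matroid E \<B>"
  shows "matroid E (dual_bases E \<B>)"
proof -
  have exch: "\<exists>b\<in>(E - B) - (E - A). insert b ((E - A) - {a}) \<in> dual_bases E \<B>"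
    if A: "A \<in> \<B>" and B: "B \<in> \<B>" and a: "a \<in> (E - A) - (E - B)" for A B a
  proof -
    have fA: "finite A" and AE: "A \<subseteq> E" using basis_finite[OF M A] basis_subset[OF M A] .
    have aB: "a \<in> B" "a \<notin> A" "a \<in> E" using a by auto
    have "indep \<B> (insert a (A \<inter> B))" unfolding indep_def using B aB by blast
    moreover have "insert a (A \<inter> B) \<subseteq> insert a A" by auto
    ultimately obtain Z where Z: "insert a (A \<inter> B) \<subseteq> Z" "Z \<subseteq> insert a A" "indep \<B> Z"
      "card Z = rank_fun \<B> (insert a A)"
      by (rule indep_extend[OF M])
    have fZ: "finite Z" using Z(2) fA finite_subset by blast
    obtain B' where B': "B' \<in> \<B>" "Z \<subseteq> B'" using Z(3) unfolding indep_def by blast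
    have eqA: "insert a A \<inter> A = A" by blast
    have "card A \<le> card Z" using rank_fun_ge[OF M A, of "insert a A"] Z(4) unfolding eqA by simp
    moreover have cAB: "card A = card B'" using card_basis[OF M] A B'(1) by metis
    ultimately have "Z = B'"
      using B'(2) basis_finite[OF M B'(1)] by (metis card_seteq)
    then have "Z \<in> \<B>" and cZ: "card Z = card A" using B' cAB by simp_all
    obtain y where y: "y \<in> A" "y \<notin> Z"
    proof -
      have "\<not> insert a A \<subseteq> Z"
        using card_mono[OF fZ, of "insert a A"] cZ fA aB by auto
      then show ?thesis using that Z(1) by auto
    qed
    have eqZ: "Z = insert a (A - {y})"
    proof (rule card_subset_eq)
      show "Z \<subseteq> insert a (A - {y})" using Z(2) y by blast
      show "card Z = card (insert a (A - {y}))"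
        using cZ y fA aB card_Suc_Diff1[OF fA y(1)] by simp
    qed (use fA in simp)
    have eqE: "insert y ((E - A) - {a}) = E - Z" unfolding eqZ using y(1) AE aB by auto
    show ?thesis
    proof (rule bexI)
      show "insert y ((E - A) - {a}) \<in> dual_bases E \<B>"
        unfolding dual_bases_def eqE using \<open>Z \<in> \<B>\<close> by (rule imageI)
      show "y \<in> (E - B) - (E - A)" using y Z(1) AE by blast
    qed
  qed
  show ?thesis
    unfolding matroid_def
  proof (intro conjI ballI)
    fix A' B' a assume A': "A' \<in> dual_bases E \<B>" and B': "B' \<in> dual_bases E \<B>" and a: "a \<in> A' - B'"
    obtain A B where "A \<in> \<B>" "A' = E - A" "B \<in> \<B>" "B' = E - B"
      using A' B' unfolding dual_bases_def by blast
    then show "\<exists>b\<in>B' - A'. insert b (A' - {a}) \<in> dual_bases E \<B>"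
      using exch[of A B a] a by metis
  next
    show "finite E" by (rule matroid_finite[OF M])
    show "dual_bases E \<B> \<noteq> {}" using M by (simp add: matroid_def dual_bases_def)
    show "B \<subseteq> E" if "B \<in> dual_bases E \<B>" for B using that unfolding dual_bases_def by blast
  qed
qed

section \<open>Packing bases\<close>

text \<open>Rado's theorem for submodular functions: as long as some \<open>A j\<close> has two elements, submodularity
  lets us delete one of them without violating the Hall condition.\<close>

lemma rado:
  fixes f :: "'b set \<Rightarrow> nat" and A :: "'j \<Rightarrow> 'b set"
  assumes J: "finite J"
    and mono: "\<And>X Y. X \<subseteq> Y \<Longrightarrow> f X \<le> f Y"
    and submod: "\<And>X Y. f (X \<union> Y) + f (X \<inter> Y) \<le> f X + f Y"
    and zero: "f {} = 0"
    and "\<And>j. j \<in> J \<Longrightarrow> finite (A j)"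
    and "\<And>K. K \<subseteq> J \<Longrightarrow> card K \<le> f (\<Union>j\<in>K. A j)"
  shows "\<exists>x. (\<forall>j\<in>J. x j \<in> A j) \<and> card J \<le> f (x ` J)"
  using assms(5,6)
proof (induction "\<Sum>j\<in>J. card (A j)" arbitrary: A rule: less_induct)
  case less
  show ?case
  proof (cases "\<exists>j\<in>J. \<exists>a\<in>A j. \<exists>b\<in>A j. a \<noteq> b")
    case False
    have ne: "A j \<noteq> {}" if "j \<in> J" for j
      using less.prems(2)[of "{j}"] that zero by auto
    define x where "x j = (SOME a. a \<in> A j)" for j
    have x: "x j \<in> A j" if "j \<in> J" for j
      unfolding x_def using ne[OF that] some_in_eq by blast
    have "(\<Union>j\<in>J. A j) = x ` J" using False x by fast
    then show ?thesis using less.prems(2)[of J] x by auto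
  next
    case True
    then obtain j a b where j: "j \<in> J" and ab: "a \<in> A j" "b \<in> A j" "a \<noteq> b" by blast
    have reduce: ?thesis
      if c: "c \<in> A j" and H: "\<And>K. K \<subseteq> J \<Longrightarrow> card K \<le> f (\<Union>i\<in>K. (A(j := A j - {c})) i)" for c
    proof -
      have "(\<Sum>i\<in>J. card ((A(j := A j - {c})) i)) < (\<Sum>i\<in>J. card (A i))"
      proof (rule sum_strict_mono_ex1[OF J])
        show "\<forall>i\<in>J. card ((A(j := A j - {c})) i) \<le> card (A i)"
          using less.prems(1) by (auto intro: card_mono)
        show "\<exists>i\<in>J. card ((A(j := A j - {c})) i) < card (A i)"
          using j card_Diff1_less[OF less.prems(1)[OF j] c] by (intro bexI[of _ j]) simp_all
      qed
      then obtain x where "\<forall>i\<in>J. x i \<in> (A(j := A j - {c})) i" "card J \<le> f (x ` J)"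
        using less.hyps[of "A(j := A j - {c})", OF _ _ H] less.prems(1) by fastforce
      then show ?thesis by (metis (full_types) DiffD1 fun_upd_apply)
    qed
    show ?thesis
    proof (rule ccontr)
      assume no: "\<not> ?thesis"
      \<comment> \<open>A family that violates the Hall condition after the deletion must contain
        \<open>j\<close>. Taking \<open>j\<close> out of it lowers the count by one, so the strict
        inequality becomes a weak one.\<close>
      have fail: "\<exists>K\<subseteq>J - {j}. f ((\<Union>i\<in>K. A i) \<union> (A j - {c})) \<le> card K" if c: "c \<in> A j" for c
      proof -
        obtain K where K: "K \<subseteq> J" "f (\<Union>i\<in>K. (A(j := A j - {c})) i) < card K"
          using reduce[OF c] no by (meson not_le)
        have jK: "j \<in> K"
        proof (rule ccontr)
          assume "j \<notin> K"
          then have "(\<Union>i\<in>K. (A(j := A j - {c})) i) = (\<Union>i\<in>K. A i)" by auto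
          then show False using K less.prems(2)[OF K(1)] by simp
        qed
        have "(\<Union>i\<in>K. (A(j := A j - {c})) i) = (\<Union>i\<in>K - {j}. A i) \<union> (A j - {c})"
          using jK by auto
        moreover have "card K = Suc (card (K - {j}))"
          using jK K(1) J by (metis card_Suc_Diff1 finite_subset)
        ultimately show ?thesis using K by (intro exI[of _ "K - {j}"]) auto
      qed
      obtain K1 where K1: "K1 \<subseteq> J - {j}" "f ((\<Union>i\<in>K1. A i) \<union> (A j - {a})) \<le> card K1"
        using fail[OF ab(1)] by blast
      obtain K2 where K2: "K2 \<subseteq> J - {j}" "f ((\<Union>i\<in>K2. A i) \<union> (A j - {b})) \<le> card K2"
        using fail[OF ab(2)] by blast
      let ?X = "(\<Union>i\<in>K1. A i) \<union> (A j - {a})" and ?Y = "(\<Union>i\<in>K2. A i) \<union> (A j - {b})"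
      have fin: "finite K1" "finite K2" using K1 K2 J finite_subset by blast+
      \<comment> \<open>As \<open>a \<noteq> b\<close>, the two deletions together still cover
        \<open>A j\<close>. Hence the union has value at least
        \<open>card (K1 \<union> K2) + 1\<close>, the intersection at least
        \<open>card (K1 \<inter> K2)\<close>, and submodularity bounds the sum by
        \<open>card K1 + card K2\<close>: a contradiction by one.\<close>
      have "(\<Union>i\<in>insert j (K1 \<union> K2). A i) \<subseteq> ?X \<union> ?Y" using ab by blast
      then have "f (\<Union>i\<in>insert j (K1 \<union> K2). A i) \<le> f (?X \<union> ?Y)" by (rule mono)
      moreover have "card (insert j (K1 \<union> K2)) \<le> f (\<Union>i\<in>insert j (K1 \<union> K2). A i)"
        by (rule less.prems(2)) (use j K1 K2 in blast)
      moreover have "card (insert j (K1 \<union> K2)) = Suc (card (K1 \<union> K2))"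
        using fin K1 K2 by (subst card_insert_disjoint) auto
      moreover have "card (K1 \<inter> K2) \<le> f (?X \<inter> ?Y)"
      proof -
        have "card (K1 \<inter> K2) \<le> f (\<Union>i\<in>K1 \<inter> K2. A i)" using less.prems(2) K1 by blast
        also have "\<dots> \<le> f (?X \<inter> ?Y)" by (rule mono) blast
        finally show ?thesis .
      qed
      moreover have "card (K1 \<union> K2) + card (K1 \<inter> K2) = card K1 + card K2"
        using card_Un_Int[OF fin] by simp
      ultimately show False using submod[of ?X ?Y] K1(2) K2(2) by linarith
    qed
  qed
qed

text \<open>Edmonds' covering theorem, by applying Rado's theorem to the direct sum of \<open>N\<close> copies of the
  matroid: \<open>(e, c)\<close> with \<open>c < u e\<close> has to choose a copy of \<open>e\<close>.\<close>

lemma matroid_covering: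
  assumes M: "matroid E \<B>" and u: "\<And>A. A \<subseteq> E \<Longrightarrow> (\<Sum>e\<in>A. u e) \<le> N * rank_fun \<B> A"
  shows "\<exists>Y. (\<forall>i<N. indep \<B> (Y i)) \<and> (\<forall>e\<in>E. u e \<le> card {i. i < N \<and> e \<in> Y i})"
proof -
  note E = matroid_finite[OF M]
  define J where "J = (SIGMA e:E. {..<u e})"
  define A where "A j = {fst j} \<times> {..<N}" for j :: "'a \<times> nat"
  define sl where "sl X i = {e. (e, i) \<in> X}" for X :: "('a \<times> nat) set" and i
  define f where "f X = (\<Sum>i<N. rank_fun \<B> (sl X i))" for X
  have J: "finite J" unfolding J_def using E by auto
  have r0: "rank_fun \<B> {} = 0" using rank_fun_le_card[OF M, of "{}"] by simp
  have "\<exists>x. (\<forall>j\<in>J. x j \<in> A j) \<and> card J \<le> f (x ` J)"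
  proof (rule rado[OF J])
    show "f X \<le> f Y" if "X \<subseteq> Y" for X Y
      unfolding f_def by (rule sum_mono, rule rank_fun_mono[OF M]) (use that in \<open>auto simp: sl_def\<close>)
    show "f (X \<union> Y) + f (X \<inter> Y) \<le> f X + f Y" for X Y
    proof -
      have "sl (X \<union> Y) i = sl X i \<union> sl Y i" "sl (X \<inter> Y) i = sl X i \<inter> sl Y i" for i
        by (auto simp: sl_def)
      then show ?thesis unfolding f_def sum.distrib[symmetric]
        by (auto intro!: sum_mono rank_fun_submodular[OF M])
    qed
    show "f {} = 0" unfolding f_def sl_def using r0 by simp
    show "finite (A j)" for j unfolding A_def by simp
    fix K assume K: "K \<subseteq> J"
    \<comment> \<open>Each \<open>A j\<close> holds all \<open>N\<close> copies of
      \<open>fst j\<close>, so the union looks the same in every layer and the Hall condition for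
      \<open>K\<close> follows from the hypothesis on \<open>u\<close> for the image of
      \<open>K\<close> under \<open>fst\<close>.\<close>
    have "sl (\<Union>j\<in>K. A j) i = fst ` K" if "i < N" for i
      using that unfolding sl_def A_def by force
    then have "f (\<Union>j\<in>K. A j) = N * rank_fun \<B> (fst ` K)" unfolding f_def by simp
    moreover have "card K \<le> (\<Sum>e\<in>fst ` K. u e)"
    proof -
      have fK: "finite (fst ` K)" using K J finite_subset by blast
      have "K \<subseteq> (SIGMA e:fst ` K. {..<u e})" using K unfolding J_def by force
      then have "card K \<le> card (SIGMA e:fst ` K. {..<u e})" by (rule card_mono[rotated]) (use fK in auto)
      also have "\<dots> = (\<Sum>e\<in>fst ` K. u e)" using fK by simp
      finally show ?thesis .
    qed
    moreover have "fst ` K \<subseteq> E" using K unfolding J_def by auto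
    ultimately show "card K \<le> f (\<Union>j\<in>K. A j)" using u[of "fst ` K"] by linarith
  qed
  then obtain x where x: "\<And>j. j \<in> J \<Longrightarrow> x j \<in> A j" and le: "card J \<le> f (x ` J)" by blast
  define Y where "Y i = sl (x ` J) i" for i
  have fX: "finite (x ` J)" using J by simp
  have fY: "finite (Y i)" for i
    using finite_vimageI[OF fX, of "\<lambda>e. (e, i)"]
    unfolding Y_def sl_def vimage_def by (simp add: inj_def)
  have XY: "card (x ` J) = (\<Sum>i<N. card (Y i))"
  proof -
    have "prod.swap ` (x ` J) = (SIGMA i:{..<N}. Y i)"
    proof -
      have "i < N" if "(e, i) \<in> x ` J" for e i using that x unfolding A_def by fastforce
      then have "p \<in> prod.swap ` (x ` J) \<longleftrightarrow> p \<in> (SIGMA i:{..<N}. Y i)" for p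
        by (cases p) (simp only: pair_in_swap_image, auto simp: Y_def sl_def)
      then show ?thesis by blast
    qed
    then have "card (prod.swap ` (x ` J)) = (\<Sum>i<N. card (Y i))" using fY by simp
    then show ?thesis by (simp add: card_image)
  qed
  have le1: "rank_fun \<B> (Y i) \<le> card (Y i)" for i by (rule rank_fun_le_card[OF M fY])
  have f_le: "f (x ` J) \<le> (\<Sum>i<N. card (Y i))"
    unfolding f_def Y_def[symmetric] by (rule sum_mono) (rule le1)
  \<comment> \<open>Sandwich: \<open>card J\<close> is at most \<open>f\<close> of the image of
    \<open>x\<close>, which is at most the sum of the \<open>card (Y i)\<close>, the size of that
    image, which is at most \<open>card J\<close>. Equality throughout makes \<open>x\<close>
    injective and every layer \<open>Y i\<close> independent.\<close>
  have cJ: "card (x ` J) = card J" using card_image_le[OF J, of x] XY f_le le by linarith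
  then have inj: "inj_on x J" using J eq_card_imp_inj_on by blast
  have eq: "(\<Sum>i<N. rank_fun \<B> (Y i)) = (\<Sum>i<N. card (Y i))"
    using f_le le XY cJ unfolding f_def Y_def[symmetric] by linarith
  have "rank_fun \<B> (Y i) = card (Y i)" if "i < N" for i
    using sum_mono_inv[OF eq] le1 that by simp
  then have ind: "indep \<B> (Y i)" if "i < N" for i
    using indep_iff_rank[OF M fY] that by blast
  have "u e \<le> card {i. i < N \<and> e \<in> Y i}" if e: "e \<in> E" for e
  proof -
    have "inj_on (\<lambda>c. snd (x (e, c))) {..<u e}"
    proof (rule inj_onI)
      fix c c' assume c: "c \<in> {..<u e}" "c' \<in> {..<u e}" and eq: "snd (x (e, c)) = snd (x (e, c'))"
      have inJ: "(e, c) \<in> J" "(e, c') \<in> J" using c e unfolding J_def by auto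
      then have "fst (x (e, c)) = e" "fst (x (e, c')) = e" using x unfolding A_def by fastforce+
      then have "x (e, c) = x (e, c')" using eq by (simp add: prod_eq_iff)
      then show "c = c'" using inj inJ by (meson inj_onD prod.inject)
    qed
    then have "u e = card ((\<lambda>c. snd (x (e, c))) ` {..<u e})" by (simp add: card_image)
    also have "\<dots> \<le> card {i. i < N \<and> e \<in> Y i}"
    proof (rule card_mono)
      show "(\<lambda>c. snd (x (e, c))) ` {..<u e} \<subseteq> {i. i < N \<and> e \<in> Y i}"
      proof (clarify)
        fix c assume "c < u e"
        then have inJ: "(e, c) \<in> J" using e unfolding J_def by auto
        then have "x (e, c) \<in> {e} \<times> {..<N}" using x unfolding A_def by fastforce
        then obtain i where i: "x (e, c) = (e, i)" "i < N" by auto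
        have "(e, i) \<in> x ` J" using i(1) inJ by (metis image_eqI)
        then show "snd (x (e, c)) < N \<and> e \<in> Y (snd (x (e, c)))"
          using i unfolding Y_def sl_def by simp
      qed
    qed simp
    finally show ?thesis .
  qed
  then show ?thesis using ind by (intro exI[of _ Y]) simp
qed

text \<open>At most \<open>m e\<close> of \<open>N\<close> bases contain \<open>e\<close> iff at
  least \<open>N - m e\<close> of their complements do, so this is covering in the dual matroid. The
  sets \<open>Y i\<close> found there are only independent; each avoids some basis, and passing to
  its complement covers no less.\<close>

lemma base_packing:
  assumes M: "matroid E \<B>"
    and m: "\<And>A. A \<subseteq> E \<Longrightarrow> \<exists>B\<in>\<B>. N * card (A \<inter> B) \<le> (\<Sum>e\<in>A. m e)"
  shows "\<exists>\<beta>. (\<forall>i<N. \<beta> i \<in> \<B>) \<and> (\<forall>e\<in>E. card {i. i < N \<and> e \<in> \<beta> i} \<le> m e)"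
proof -
  note M' = matroid_dual[OF M] and E = matroid_finite[OF M]
  have "(\<Sum>e\<in>A. N - m e) \<le> N * rank_fun (dual_bases E \<B>) A" if A: "A \<subseteq> E" for A
  proof -
    \<comment> \<open>Subtraction is truncated. On \<open>A'\<close> the differences
      \<open>N - m e\<close> are genuine, and outside they vanish, so the hypothesis is applied to
      \<open>A'\<close> and not to \<open>A\<close>.\<close>
    define A' where "A' = {e\<in>A. m e < N}"
    have "finite A" using A E finite_subset by metis
    then have A': "A' \<subseteq> A" "A' \<subseteq> E" "finite A'" "finite A"
      using A unfolding A'_def by auto
    obtain B where B: "B \<in> \<B>" "N * card (A' \<inter> B) \<le> (\<Sum>e\<in>A'. m e)" using m[OF A'(2)] by blast
    have "(\<Sum>e\<in>A. N - m e) = (\<Sum>e\<in>A'. N - m e)"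
      by (rule sum.mono_neutral_right) (use A' in \<open>auto simp: A'_def\<close>)
    moreover have "(\<Sum>e\<in>A'. N - m e) + (\<Sum>e\<in>A'. m e) = N * card A'"
      unfolding sum.distrib[symmetric] by (simp add: A'_def)
    moreover have "card A' = card (A' \<inter> B) + card (A' - B)" by (rule card_Int_Diff[OF A'(3)])
    then have "N * card A' = N * card (A' \<inter> B) + N * card (A' - B)" by (simp add: distrib_left)
    ultimately have "(\<Sum>e\<in>A. N - m e) \<le> N * card (A' - B)" using B(2) by linarith
    moreover have "card (A' - B) \<le> rank_fun (dual_bases E \<B>) A"
    proof -
      have "A' \<inter> (E - B) = A' - B" using A' by blast
      moreover have "E - B \<in> dual_bases E \<B>" using B(1) unfolding dual_bases_def by blast
      ultimately have "card (A' - B) \<le> rank_fun (dual_bases E \<B>) A'"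
        using rank_fun_ge[OF M', of "E - B" A'] by simp
      then show ?thesis using rank_fun_mono[OF M' A'(1)] by linarith
    qed
    ultimately show ?thesis by (meson le_trans mult_le_mono2)
  qed
  from matroid_covering[OF M' this]
  obtain Y where Y: "\<And>i. i < N \<Longrightarrow> indep (dual_bases E \<B>) (Y i)"
    "\<And>e. e \<in> E \<Longrightarrow> N - m e \<le> card {i. i < N \<and> e \<in> Y i}"
    by blast
  have "\<exists>B\<in>\<B>. Y i \<inter> B = {}" if "i < N" for i
    using Y(1)[OF that] unfolding indep_def dual_bases_def by auto
  then obtain \<beta> where \<beta>: "\<And>i. i < N \<Longrightarrow> \<beta> i \<in> \<B>" "\<And>i. i < N \<Longrightarrow> Y i \<inter> \<beta> i = {}" by metis
  have "card {i. i < N \<and> e \<in> \<beta> i} \<le> m e" if e: "e \<in> E" for e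
  proof -
    have "card {i. i < N \<and> e \<in> \<beta> i} + card {i. i < N \<and> e \<in> Y i}
        = card ({i. i < N \<and> e \<in> \<beta> i} \<union> {i. i < N \<and> e \<in> Y i})"
      using \<beta>(2) by (subst card_Un_disjoint) auto
    also have "\<dots> \<le> card {..<N}" by (rule card_mono) auto
    finally show ?thesis using Y(2)[OF e] by simp
  qed
  then show ?thesis using \<beta>(1) by (intro exI[of _ \<beta>]) simp
qed

section \<open>Fractional covers\<close>

definition transversal :: "'e set \<Rightarrow> 'e set set \<Rightarrow> 'e set \<Rightarrow> bool" where
  "transversal E \<B> C \<longleftrightarrow> C \<subseteq> E \<and> (\<forall>B\<in>\<B>. C \<inter> B \<noteq> {})"

definition frac_cover :: "'e set \<Rightarrow> 'e set set \<Rightarrow> ('e \<Rightarrow> real) \<Rightarrow> bool" where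
  "frac_cover E \<B> x \<longleftrightarrow> (\<forall>e\<in>E. 0 \<le> x e) \<and> (\<forall>C. transversal E \<B> C \<longrightarrow> 1 \<le> sum x C)"

text \<open>The threshold \<mu> lets sums over parts of \<open>U\<close> and of \<open>A - U\<close>
  be compared by counting elements. Its sign is recorded because it would not follow from the other
  clauses when \<open>U\<close> is empty, which happens below for \<open>d = 1\<close>.\<close>

lemma ex_smallest_subset:
  fixes x :: "'a \<Rightarrow> real"
  assumes "finite A" "m \<le> card A" "\<And>a. a \<in> A \<Longrightarrow> 0 \<le> x a"
  obtains U \<mu> where "U \<subseteq> A" "card U = m" "0 \<le> \<mu>" "\<And>u. u \<in> U \<Longrightarrow> x u \<le> \<mu>"
    "\<And>a. a \<in> A - U \<Longrightarrow> \<mu> \<le> x a"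
proof -
  have "\<exists>U \<mu>. U \<subseteq> A \<and> card U = m \<and> 0 \<le> \<mu> \<and> (\<forall>u\<in>U. x u \<le> \<mu>) \<and> (\<forall>a\<in>A - U. \<mu> \<le> x a)"
    using assms(2)
  proof (induction m)
    case 0
    then show ?case using assms(3) by (intro exI[of _ "{}"] exI[of _ "0::real"]) auto
  next
    case (Suc m)
    then obtain U \<mu> where U: "U \<subseteq> A" "card U = m" "0 \<le> \<mu>" "\<forall>u\<in>U. x u \<le> \<mu>" "\<forall>a\<in>A - U. \<mu> \<le> x a"
      by auto
    have "A - U \<noteq> {}" using U(1,2) Suc.prems by auto
    then obtain b where b: "b \<in> A - U" "\<forall>a\<in>A - U. x b \<le> x a"
      using ex_is_arg_min_if_finite[of "A - U" x] assms(1) by (auto simp: is_arg_min_linorder)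
    have "finite U" using U(1) assms(1) finite_subset by metis
    then have "card (insert b U) = Suc m" using b(1) U(2) by simp
    moreover have "0 \<le> x b" using assms(3) b(1) by blast
    moreover have "x u \<le> x b" if "u \<in> insert b U" for u
      using that U(4,5) b(1) by force
    moreover have "x b \<le> x a" if "a \<in> A - insert b U" for a using that b(2) by blast
    moreover have "insert b U \<subseteq> A" using U(1) b(1) by blast
    ultimately show ?case by (intro exI[of _ "insert b U"] exI[of _ "x b"]) blast
  qed
  then show ?thesis using that by blast
qed

text \<open>If \<open>x a\<close> lies below \<sigma>\<open>/ 2\<close>, every other value is at
  least \<sigma>\<open>- x a\<close>, hence above \<sigma>\<open>/ 2\<close>; with at least two
  elements these gains make up for the single deficit.\<close>

lemma sum_ge_if_pair_sums_ge:
  fixes x :: "'a \<Rightarrow> real"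
  assumes "finite D" "2 \<le> card D" "0 \<le> \<sigma>"
    and pair: "\<And>a b. a \<in> D \<Longrightarrow> b \<in> D \<Longrightarrow> a \<noteq> b \<Longrightarrow> \<sigma> \<le> x a + x b"
  shows "real (card D) * \<sigma> / 2 \<le> sum x D"
proof (cases "\<exists>a\<in>D. x a < \<sigma> / 2")
  case False
  then have "of_nat (card D) * (\<sigma> / 2) \<le> sum x D" by (intro sum_bounded_below) auto
  then show ?thesis by simp
next
  case True
  then obtain a where a: "a \<in> D" "x a < \<sigma> / 2" by blast
  have "of_nat (card (D - {a})) * (\<sigma> - x a) \<le> sum x (D - {a})"
    by (intro sum_bounded_below) (use pair[OF a(1)] in force)
  moreover have "sum x D = x a + sum x (D - {a})" by (rule sum.remove[OF assms(1) a(1)])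
  moreover have "real (card (D - {a})) = real (card D) - 1" using a(1) assms by simp
  moreover have "real (card D) * \<sigma> / 2 \<le> x a + (real (card D) - 1) * (\<sigma> - x a)"
  proof -
    have "0 \<le> (real (card D) - 2) * (\<sigma> / 2 - x a)" using a(2) assms(2) by (intro mult_nonneg_nonneg) auto
    then show ?thesis by (simp add: field_simps)
  qed
  ultimately show ?thesis by simp
qed

text \<open>Transversals are the dependent sets of the dual matroid, so for a matroid \<open>transversal_card\<close> says
  that the dual, of rank \<open>d\<close>, is paving.\<close>

locale dual_paving =
  fixes E :: "'e set" and \<B> :: "'e set set" and d k :: nat
  assumes finE: "finite E" and cardE: "card E = d + k"
    and kpos: "1 \<le> k" and kd: "k \<le> d"
    and ne: "\<B> \<noteq> {}" and sub: "\<And>B. B \<in> \<B> \<Longrightarrow> B \<subseteq> E" and cardB: "\<And>B. B \<in> \<B> \<Longrightarrow> card B = k"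
    and transversal_card: "\<And>C. transversal E \<B> C \<Longrightarrow> d \<le> card C"
begin

lemma transversal_subset: "transversal E \<B> C \<Longrightarrow> C \<subseteq> E"
  by (simp add: transversal_def)

lemma finite_ground_subset: "A \<subseteq> E \<Longrightarrow> finite A"
  using finE finite_subset by metis

lemma not_transversalE:
  assumes "A \<subseteq> E" "\<not> transversal E \<B> A"
  obtains B where "B \<in> \<B>" "A \<inter> B = {}"
  using assms unfolding transversal_def by blast

lemma transversal_if_card:
  assumes "C \<subseteq> E" "card C = Suc d"
  shows "transversal E \<B> C"
proof (rule ccontr)
  assume "\<not> transversal E \<B> C"
  then obtain B where B: "B \<in> \<B>" "C \<inter> B = {}" using assms(1) not_transversalE by blast
  have "card (C \<union> B) = Suc d + k"
    using B assms cardB[OF B(1)] finite_ground_subset[OF assms(1)] finite_ground_subset[OF sub[OF B(1)]]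
    by (simp add: card_Un_disjoint)
  moreover have "card (C \<union> B) \<le> d + k"
    using card_mono[OF finE, of "C \<union> B"] assms(1) sub[OF B(1)] cardE by auto
  ultimately show False by simp
qed

text \<open>The source of the upper bounds for \<open>g(A)\<close>. If
  \<open>card A = d + j\<close>, a set \<open>Y\<close> of size \<open>d - 1\<close>, never a
  transversal, yields \<open>j + 1\<close>, and one of size \<open>d\<close> that is not a
  transversal yields \<open>j\<close>.\<close>

lemma basis_avoiding:
  assumes "Y \<subseteq> A" "A \<subseteq> E" "\<not> transversal E \<B> Y"
  obtains B where "B \<in> \<B>" "card (A \<inter> B) \<le> card A - card Y"
proof -
  obtain B where B: "B \<in> \<B>" "Y \<inter> B = {}" using assms not_transversalE[of Y] by blast
  have "card (A \<inter> B) \<le> card (A - Y)"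
    by (rule card_mono) (use B finite_ground_subset[OF assms(2)] in auto)
  then show ?thesis
    using that B(1) card_Diff_subset[OF finite_subset[OF assms(1) finite_ground_subset[OF assms(2)]] assms(1)]
    by simp
qed

section \<open>Trading a cover restricted to \<open>A\<close> for a cover of the whole ground
  set\<close>

lemma frac_cover_const: "frac_cover E \<B> (\<lambda>_. 1 / real d)"
proof -
  have "1 \<le> real (card C) * (1 / real d)" if "transversal E \<B> C" for C
    using transversal_card[OF that] kpos kd by simp
  then show ?thesis unfolding frac_cover_def by simp
qed

lemma sum_const: "(\<Sum>e\<in>E. 1 / real d) = real (d + k) / real d"
  using cardE by simp

text \<open>The \<open>d\<close> smallest weights on \<open>A\<close> sum to at least 1, so the
  largest of them, and with it each of the other \<open>j\<close> weights, is at least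
  \<open>1 / d\<close>. Hence \<open>sum x A \<ge> (d + j) / d\<close>, and for
  \<open>c = card (A \<inter> B)\<close> only the integer inequality
  \<open>c (d + k) \<le> k (d + j)\<close> is left. It holds for \<open>c = j\<close>, since
  \<open>j < k\<close>; the basis provided by paving may have \<open>c = j + 1\<close>.\<close>

lemma compare_uniform_case:
  assumes x: "frac_cover E \<B> x" and A: "A \<subseteq> E" and dA: "d \<le> card A"
    and nsub: "\<exists>B\<in>\<B>. \<not> B \<subseteq> A" and all: "\<And>D. D \<subseteq> A \<Longrightarrow> card D = d \<Longrightarrow> transversal E \<B> D"
  shows "\<exists>B\<in>\<B>. real (card (A \<inter> B)) * (\<Sum>e\<in>E. 1 / real d) \<le> real k * sum x A"
proof -
  have fA: "finite A" by (rule finite_ground_subset[OF A])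
  have d: "1 \<le> d" using kpos kd by simp
  obtain j where j: "card A = d + j" using dA le_Suc_ex by blast
  have "A \<noteq> E" using nsub sub by blast
  then have jk: "j < k" using psubset_card_mono[OF finE, of A] A j cardE by auto
  have x0: "0 \<le> x e" if "e \<in> A" for e using x A that unfolding frac_cover_def by blast
  obtain U \<mu> where U: "U \<subseteq> A" "card U = d" "0 \<le> \<mu>" "\<And>u. u \<in> U \<Longrightarrow> x u \<le> \<mu>"
    "\<And>a. a \<in> A - U \<Longrightarrow> \<mu> \<le> x a"
    using ex_smallest_subset[OF fA dA, of x] x0 by blast
  have fU: "finite U" using U(1) fA finite_subset by metis
  have xU: "1 \<le> sum x U" using all[OF U(1,2)] x unfolding frac_cover_def by blast
  have "sum x U \<le> of_nat (card U) * \<mu>" by (rule sum_bounded_above) (rule U(4))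
  then have "1 / real d \<le> \<mu>" using xU U(2) d by (simp add: field_simps)
  moreover have "real (card (A - U)) * \<mu> \<le> sum x (A - U)"
    by (rule sum_bounded_below) (rule U(5))
  moreover have "card (A - U) = j" using card_Diff_subset[OF fU U(1)] j U(2) by simp
  ultimately have "real j * (1 / real d) \<le> sum x (A - U)"
    by (metis mult_left_mono of_nat_0_le_iff order_trans)
  moreover have "sum x A = sum x (A - U) + sum x U" by (rule sum.subset_diff[OF U(1) fA])
  moreover have "real (d + j) / real d = 1 + real j * (1 / real d)" using d by (simp add: field_simps)
  ultimately have xA: "real (d + j) / real d \<le> sum x A" using xU by linarith
  have main: "real c * (real (d + k) / real d) \<le> real k * sum x A" if "c * (d + k) \<le> k * (d + j)" for c
  proof -
    have "real c * real (d + k) \<le> real k * real (d + j)" using that by (metis of_nat_le_iff of_nat_mult)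
    then have "real c * (real (d + k) / real d) \<le> real k * (real (d + j) / real d)"
      using d by (simp add: divide_right_mono)
    also have "\<dots> \<le> real k * sum x A" by (rule mult_left_mono[OF xA]) simp
    finally show ?thesis .
  qed
  show ?thesis
  proof (cases "j = k - 1")
    case True
    \<comment> \<open>Here \<open>c = j + 1 = k\<close> would violate the integer inequality. A
      basis that sticks out of \<open>A\<close> loses an element and gives
      \<open>c \<le> k - 1 = j\<close>.\<close>
    obtain B where B: "B \<in> \<B>" "\<not> B \<subseteq> A" using nsub by blast
    have "card (A \<inter> B) < card B"
      by (rule psubset_card_mono) (use B finite_ground_subset[OF sub[OF B(1)]] in auto)
    then have "card (A \<inter> B) \<le> j" using cardB[OF B(1)] True by simp
    then have "card (A \<inter> B) * (d + k) \<le> j * (d + k)" by (rule mult_le_mono1)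
    also have "\<dots> \<le> k * (d + j)" using jk by (simp add: algebra_simps)
    finally show ?thesis using B(1) main unfolding sum_const by blast
  next
    case False
    then have jk2: "j + 2 \<le> k" using jk by simp
    \<comment> \<open>By paving a set of size \<open>d - 1\<close> is avoided by some basis, so
      \<open>c \<le> j + 1\<close>; the gap between \<open>j\<close> and \<open>k\<close> is now
      large enough for that.\<close>
    obtain Y where Y: "Y \<subseteq> A" "card Y = d - 1"
      using obtain_subset_with_card_n[of "d - 1" A] dA d by (metis diff_le_self le_trans)
    have "\<not> transversal E \<B> Y" using transversal_card[of Y] Y(2) d by auto
    then obtain B where B: "B \<in> \<B>" "card (A \<inter> B) \<le> card A - card Y"
      using basis_avoiding[OF Y(1) A] by blast
    then have "card (A \<inter> B) * (d + k) \<le> (j + 1) * (d + k)" using j Y(2) d by (intro mult_le_mono1) simp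
    also have "\<dots> \<le> k * (d + j)"
    proof -
      \<comment> \<open>With this \<open>i\<close> the inequality amounts to
        \<open>k \<le> (i + 1) d\<close>, which follows from \<open>k \<le> d\<close>.\<close>
      obtain i where i: "k = j + 2 + i" using jk2 le_Suc_ex by blast
      have "d * 1 \<le> d * Suc i" by (intro mult_le_mono2) simp
      then show ?thesis using kd unfolding i by (simp add: algebra_simps)
    qed
    finally show ?thesis using B(1) main unfolding sum_const by blast
  qed
qed

text \<open>Extension by the constant \<open>w = sum x A / j\<close> outside \<open>A\<close>. The worst transversals consist of the \<open>d - 1\<close>
  elements of \<open>A\<close> of smallest weight, of total weight \<open>s\<close>, and one new element. Any two other elements
  of \<open>A\<close> complete them to a transversal, so if \<open>s + w < 1\<close> then \<open>sum x A\<close> would be too large.\<close>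

lemma compare_extension_case:
  assumes x: "frac_cover E \<B> x" and A: "A \<subseteq> E" and j: "card A = d + j" "1 \<le> j" "j < k"
    and small: "sum x A * (real d * real k) < real j * real (d + k)"
  defines "w \<equiv> sum x A / real j"
  defines "y \<equiv> (\<lambda>e. if e \<in> A then x e else w)"
  shows "frac_cover E \<B> y" and "real j * sum y E = real k * sum x A"
proof -
  have fA: "finite A" by (rule finite_ground_subset[OF A])
  have d: "1 \<le> d" using kpos kd by simp
  have x0: "0 \<le> x e" if "e \<in> A" for e using x A that unfolding frac_cover_def by blast
  have w0: "0 \<le> w" unfolding w_def using x0 by (simp add: sum_nonneg)
  have jw: "real j * w = sum x A" unfolding w_def using j by simp
  have "d - 1 \<le> card A" using j by simp
  then obtain U \<mu> where U: "U \<subseteq> A" "card U = d - 1" "0 \<le> \<mu>" "\<And>u. u \<in> U \<Longrightarrow> x u \<le> \<mu>"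
    "\<And>a. a \<in> A - U \<Longrightarrow> \<mu> \<le> x a"
    using ex_smallest_subset[OF fA, of "d - 1" x] x0 by blast
  define s where "s = sum x U"
  define D where "D = A - U"
  have fU: "finite U" and fD: "finite D" using U(1) fA finite_subset unfolding D_def by auto
  have xA: "sum x A = sum x D + s" unfolding D_def s_def by (rule sum.subset_diff[OF U(1) fA])
  have s0: "0 \<le> s" unfolding s_def using x0 U(1) by (intro sum_nonneg) auto
  have cD: "card D = j + 1" unfolding D_def using card_Diff_subset[OF fU U(1)] j U(2) d by simp
  have "real (card D) * \<mu> \<le> sum x D" unfolding D_def by (rule sum_bounded_below) (rule U(5))
  then have "real j * \<mu> + \<mu> \<le> real j * w" using jw xA s0 cD by (simp add: algebra_simps)
  then have "real j * \<mu> \<le> real j * w" using U(3) by linarith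
  then have \<mu>w: "\<mu> \<le> w" using j(2) by simp
  have sw: "1 \<le> s + w"
  proof (rule ccontr)
    assume neg: "\<not> ?thesis"
    define \<sigma> where "\<sigma> = 1 - s"
    have \<sigma>: "w < \<sigma>" using neg unfolding \<sigma>_def by simp
    have "real (card D) * \<sigma> / 2 \<le> sum x D"
    proof (rule sum_ge_if_pair_sums_ge[OF fD])
      fix a b assume ab: "a \<in> D" "b \<in> D" "a \<noteq> b"
      have "card (insert a (insert b U)) = Suc d" using ab U(2) fU d unfolding D_def by simp
      moreover have "insert a (insert b U) \<subseteq> E" using ab U(1) A unfolding D_def by blast
      ultimately have "transversal E \<B> (insert a (insert b U))" by (intro transversal_if_card)
      then have "1 \<le> sum x (insert a (insert b U))" using x unfolding frac_cover_def by blast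
      also have "\<dots> = x a + x b + s" using ab fU unfolding D_def s_def by simp
      finally show "\<sigma> \<le> x a + x b" unfolding \<sigma>_def by simp
    qed (use cD j(2) \<sigma> w0 in simp_all)
    then have 1: "(real j - 1) * \<sigma> / 2 + 1 \<le> real j * w"
      using jw xA cD unfolding \<sigma>_def by (simp add: field_simps)
    have 2: "real j * w \<le> real j * \<sigma>" using \<sigma> by (simp add: mult_left_mono)
    \<comment> \<open>Substituting this lower bound for \<sigma> into \<open>1\<close> gives
      \<open>sum x A \<ge> 2 j / (j + 1)\<close>. But \<open>small\<close> together with
      \<open>j + 1 \<le> k \<le> d\<close> forces \<open>sum x A < 2 j / (j + 1)\<close>.\<close>
    have \<sigma>2: "2 \<le> (real j + 1) * \<sigma>" using 1 2 by (simp add: field_simps)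
    have "(real j - 1) * 2 \<le> (real j - 1) * ((real j + 1) * \<sigma>)"
      using \<sigma>2 j(2) by (intro mult_left_mono) auto
    then have "2 * real j \<le> (real j + 1) * ((real j - 1) * \<sigma> / 2 + 1)"
      by (simp add: field_simps)
    also have "\<dots> \<le> (real j + 1) * (real j * w)" by (rule mult_left_mono[OF 1]) simp
    finally have 3: "2 * real j \<le> (real j + 1) * sum x A" using jw by simp
    have "(j + 1) * (d + k) \<le> 2 * (d * k)"
    proof -
      have "(j + 1) * (d + k) \<le> k * (d + d)" using j(3) kd by (intro mult_le_mono) auto
      then show ?thesis by (simp add: algebra_simps)
    qed
    then have 4: "(real j + 1) * real (d + k) \<le> 2 * (real d * real k)"
      by (metis (no_types, opaque_lifting) of_nat_1 of_nat_add of_nat_le_iff of_nat_mult of_nat_numeral)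
    have dk: "0 < real d * real k" using d kpos by simp
    have "2 * real j * (real d * real k) \<le> (real j + 1) * (sum x A * (real d * real k))"
      using mult_right_mono[OF 3 less_imp_le[OF dk]] by (simp add: mult.assoc)
    also have "\<dots> < (real j + 1) * (real j * real (d + k))"
      by (rule mult_strict_left_mono[OF small]) simp
    also have "\<dots> \<le> real j * (2 * (real d * real k))"
      using mult_left_mono[OF 4, of "real j"] by (simp add: mult_ac)
    finally show False by simp
  qed
  have "1 \<le> sum y C" if C: "transversal E \<B> C" for C
  proof (cases "C \<subseteq> A")
    case True
    then have "sum y C = sum x C" unfolding y_def by (intro sum.cong) auto
    then show ?thesis using x C unfolding frac_cover_def by simp
  next
    case False
    have fC: "finite C" by (rule finite_ground_subset[OF transversal_subset[OF C]])
    define t where "t = card (C - A)"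
    have t: "1 \<le> t" unfolding t_def using False fC by (simp add: Suc_leI card_gt_0_iff)
    define p where "p = card (C \<inter> A - U)"
    have CAU: "C \<inter> A \<inter> U = C \<inter> U" using U(1) by blast
    have fCA: "finite (C \<inter> A)" using fC by simp
    have cCA: "card (C \<inter> A) = card (C \<inter> U) + p"
      unfolding p_def using card_Int_Diff[OF fCA, of U] CAU by simp
    have cU: "card U = card (U - C) + card (C \<inter> U)"
      using card_Int_Diff[OF fU, of C] by (simp add: Int_commute)
    have "card C = card (C \<inter> A) + t" unfolding t_def by (rule card_Int_Diff[OF fC])
    \<comment> \<open>Compare \<open>C\<close> with \<open>U\<close> plus one outside element, of
      total weight \<open>s + w\<close>. The elements of \<open>U\<close> missing from
      \<open>C\<close>, of weight at most \<mu>, are replaced by at least as many others: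
      \<open>p\<close> from \<open>A - U\<close> and \<open>t - 1\<close> from outside
      \<open>A\<close>, all of weight at least \<mu>.\<close>
    then have count: "card (U - C) + 1 \<le> p + t"
      using transversal_card[OF C] cCA cU U(2) d by linarith
    have "sum y C = sum y (C \<inter> A) + sum y (C - A)"
      using sum.Int_Diff[OF fC] .
    also have "sum y (C - A) = real t * w" unfolding t_def y_def by simp
    also have "sum y (C \<inter> A) = sum x (C \<inter> A)" unfolding y_def by (intro sum.cong) auto
    also have "sum x (C \<inter> A) = sum x (C \<inter> U) + sum x (C \<inter> A - U)"
      using sum.Int_Diff[OF fCA, of x U] CAU by simp
    finally have eq: "sum y C = sum x (C \<inter> U) + sum x (C \<inter> A - U) + real t * w" .
    have "s = sum x (U \<inter> C) + sum x (U - C)" unfolding s_def by (rule sum.Int_Diff[OF fU])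
    moreover have "sum x (U - C) \<le> real (card (U - C)) * \<mu>"
      by (rule sum_bounded_above) (use U(4) in auto)
    moreover have "real p * \<mu> \<le> sum x (C \<inter> A - U)"
      unfolding p_def by (rule sum_bounded_below) (use U(5) in auto)
    moreover have "real (card (U - C)) * \<mu> + w \<le> real p * \<mu> + real t * w"
    proof -
      have "(real t - 1) * \<mu> \<le> (real t - 1) * w" using \<mu>w t by (intro mult_left_mono) auto
      moreover have "real (card (U - C)) * \<mu> \<le> (real p + (real t - 1)) * \<mu>"
        using count U(3) by (intro mult_right_mono) auto
      ultimately show ?thesis by (simp add: algebra_simps)
    qed
    ultimately show ?thesis using eq sw by (simp add: Int_commute)
  qed
  moreover have "0 \<le> y e" if "e \<in> E" for e using x0 w0 unfolding y_def by simp
  ultimately show "frac_cover E \<B> y" unfolding frac_cover_def by blast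
  have "card (E - A) = k - j" using card_Diff_subset[OF fA A] cardE j(1) by simp
  then have "sum y (E - A) = (real k - real j) * w" unfolding y_def using j(3) by simp
  moreover have "sum y A = sum x A" unfolding y_def by (intro sum.cong) auto
  ultimately have "sum y E = (real k - real j) * w + sum x A"
    using sum.subset_diff[OF A finE, of y] by simp
  then have "real j * sum y E = real j * ((real k - real j) * w + sum x A)" by simp
  also have "\<dots> = (real k - real j) * (real j * w) + real j * sum x A"
    by (simp add: algebra_simps)
  finally show "real j * sum y E = real k * sum x A" unfolding jw by (simp add: algebra_simps)
qed

text \<open>\<open>B\<close> stands in for the minimum \<open>g(A)\<close>: a single basis suffices
  for the packing criterion. The cover \<open>y\<close> is later used only through the bound of
  \<open>sum y E\<close> below by \<tau>.\<close>

proposition frac_cover_compare: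
  assumes x: "frac_cover E \<B> x" and A: "A \<subseteq> E"
  shows "\<exists>B\<in>\<B>. \<exists>y. frac_cover E \<B> y \<and> real (card (A \<inter> B)) * sum y E \<le> real k * sum x A"
proof -
  have fA: "finite A" by (rule finite_ground_subset[OF A])
  have d: "1 \<le> d" using kpos kd by simp
  have x0: "0 \<le> x e" if "e \<in> A" for e using x A that unfolding frac_cover_def by blast
  have xA0: "0 \<le> sum x A" using x0 by (intro sum_nonneg)
  show ?thesis
  proof (cases "transversal E \<B> A")
    case False
    then obtain B where B: "B \<in> \<B>" "A \<inter> B = {}" using not_transversalE[OF A] by blast
    then show ?thesis using x xA0 by (intro bexI[of _ B] exI[of _ x]) auto
  next
    case T: True
    have dA: "d \<le> card A" by (rule transversal_card[OF T])
    \<comment> \<open>In the three cases some basis meets \<open>A\<close> in \<open>k\<close>, at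
      most \<open>j + 1\<close> and at most \<open>j\<close> elements, where
      \<open>card A = d + j\<close>; the cover used is \<open>x\<close> cut off outside
      \<open>A\<close>, the constant \<open>1 / d\<close>, and the extension of \<open>x\<close> or
      again \<open>1 / d\<close>.\<close>
    consider (sub) "\<forall>B\<in>\<B>. B \<subseteq> A"
      | (unif) "\<exists>B\<in>\<B>. \<not> B \<subseteq> A" "\<forall>D. D \<subseteq> A \<and> card D = d \<longrightarrow> transversal E \<B> D"
      | (ext) D where "\<exists>B\<in>\<B>. \<not> B \<subseteq> A" "D \<subseteq> A" "card D = d" "\<not> transversal E \<B> D"
      by blast
    then show ?thesis
    proof cases
      case sub
      define y where "y = (\<lambda>e. if e \<in> A then x e else 0)"
      have "1 \<le> sum y C" if C: "transversal E \<B> C" for C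
      proof -
        have "transversal E \<B> (C \<inter> A)" using C sub unfolding transversal_def by blast
        then have "1 \<le> sum x (C \<inter> A)" using x unfolding frac_cover_def by blast
        also have "\<dots> = sum y C"
          unfolding y_def by (rule sum.inter_restrict[OF finite_ground_subset[OF transversal_subset[OF C]]])
        finally show ?thesis .
      qed
      then have "frac_cover E \<B> y" unfolding frac_cover_def y_def using x0 by auto
      moreover have "sum y E = sum x A"
        unfolding y_def using sum.inter_restrict[OF finE, of x A] A by (simp add: Int_absorb1)
      moreover obtain B where "B \<in> \<B>" using ne by blast
      moreover then have "card (A \<inter> B) = k" using sub cardB by (simp add: Int_absorb1)
      ultimately show ?thesis by (intro bexI[of _ B] exI[of _ y]) auto
    next
      case unif
      then show ?thesis using compare_uniform_case[OF x A dA] frac_cover_const by blast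
    next
      case ext
      obtain j where j: "card A = d + j" using dA le_Suc_ex by blast
      have "A \<noteq> E" using ext(1) local.sub by blast
      then have jk: "j < k" using psubset_card_mono[OF finE, of A] A j cardE by auto
      obtain B where B: "B \<in> \<B>" "card (A \<inter> B) \<le> j"
        using basis_avoiding[OF ext(2) A ext(4)] j ext(3) by (metis add_diff_cancel_left')
      have goal: ?thesis if "frac_cover E \<B> y" "real j * sum y E \<le> real k * sum x A" for y
      proof -
        have "0 \<le> sum y E" using that(1) unfolding frac_cover_def by (simp add: sum_nonneg)
        then have "real (card (A \<inter> B)) * sum y E \<le> real j * sum y E"
          using B(2) by (intro mult_right_mono) auto
        then show ?thesis using B(1) that by (intro bexI[of _ B] exI[of _ y]) auto
      qed
      show ?thesis
      \<comment> \<open>The inequality says precisely that the constant cover is cheap enough. The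
        case \<open>j = 0\<close> is set apart because the extension divides by
        \<open>j\<close>.\<close>
      proof (cases "j = 0 \<or> real j * real (d + k) \<le> sum x A * (real d * real k)")
        case True
        have "real j * (\<Sum>e\<in>E. 1 / real d) \<le> real k * sum x A"
          unfolding sum_const using True d xA0 by (auto simp: field_simps)
        then show ?thesis by (rule goal[OF frac_cover_const])
      next
        case False
        then show ?thesis using compare_extension_case[OF x A j _ jk] goal by force
      qed
    qed
  qed
qed

end

section \<open>Ideals spanned by monomials\<close>

lemma poly_mapping_sum_singles:
  "p = (\<Sum>m\<in>Poly_Mapping.keys p. Poly_Mapping.single m (Poly_Mapping.lookup p m))"
proof (rule poly_mapping_eqI)
  fix u
  have "(\<Sum>m\<in>Poly_Mapping.keys p. Poly_Mapping.lookup (Poly_Mapping.single m (Poly_Mapping.lookup p m)) u)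
      = (\<Sum>m\<in>Poly_Mapping.keys p. if m = u then Poly_Mapping.lookup p u else 0)"
    by (intro sum.cong) (auto simp: lookup_single when_def)
  then show "Poly_Mapping.lookup p u = Poly_Mapping.lookup
      (\<Sum>m\<in>Poly_Mapping.keys p. Poly_Mapping.single m (Poly_Mapping.lookup p m)) u"
    by (simp add: lookup_sum in_keys_iff)
qed

text \<open>All ideals that occur are spanned by monomials, which reduces ideal arithmetic to sets
  of exponents. \<open>U\<close> lists all exponents that may occur, not just those of
  generators.\<close>

definition monomial_span :: "('e \<Rightarrow>\<^sub>0 nat) set \<Rightarrow> ('e, 'k::field) mpoly set" where
  "monomial_span U = {p. Poly_Mapping.keys p \<subseteq> U}"

definition exponents :: "'e set \<Rightarrow> ('e \<Rightarrow>\<^sub>0 nat) set" where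
  "exponents E = {m. Poly_Mapping.keys m \<subseteq> E}"

definition weight :: "'e set \<Rightarrow> ('e \<Rightarrow>\<^sub>0 nat) \<Rightarrow> nat" where
  "weight C m = (\<Sum>e\<in>C. Poly_Mapping.lookup m e)"

lemma weight_add: "weight C (m + m') = weight C m + weight C m'"
  by (simp add: weight_def lookup_add sum.distrib)

lemma weight_single:
  assumes "finite C"
  shows "weight C (Poly_Mapping.single e c) = (if e \<in> C then c else 0)"
proof -
  have "weight C (Poly_Mapping.single e c) = (\<Sum>i\<in>C. if i = e then c else 0)"
    unfolding weight_def by (intro sum.cong) (auto simp: lookup_single when_def)
  then show ?thesis using assms by simp
qed

lemma weight_mono: "finite C \<Longrightarrow> C' \<subseteq> C \<Longrightarrow> weight C' m \<le> weight C m"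
  unfolding weight_def by (rule sum_mono2) auto

lemma exp_degree_weight:
  assumes "finite E" "m \<in> exponents E"
  shows "exp_degree m = weight E m"
  unfolding exp_degree_def weight_def
  by (rule sum.mono_neutral_left) (use assms in \<open>auto simp: exponents_def in_keys_iff\<close>)

lemma exponents_add: "m + m' \<in> exponents E \<longleftrightarrow> m \<in> exponents E \<and> m' \<in> exponents E"
  by (auto simp: exponents_def in_keys_iff lookup_add subset_iff)

lemma exponents_single: "e \<in> E \<Longrightarrow> Poly_Mapping.single e c \<in> exponents E"
  by (auto simp: exponents_def)

lemma carrier_mpoly_ring: "carrier (mpoly_ring E) = monomial_span (exponents E)"
  by (auto simp: mpoly_ring_def monomial_span_def exponents_def)

lemma single_in_monomial_span: "Poly_Mapping.single m c \<in> monomial_span U \<longleftrightarrow> c = 0 \<or> m \<in> U"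
  by (auto simp: monomial_span_def)

lemma monomial_span_mono: "U \<subseteq> V \<Longrightarrow> monomial_span U \<subseteq> monomial_span V"
  by (auto simp: monomial_span_def)

lemma monomial_span_subset_iff:
  "(monomial_span U :: ('e, 'k::field) mpoly set) \<subseteq> monomial_span V \<longleftrightarrow> U \<subseteq> V"
proof
  assume le: "(monomial_span U :: ('e, 'k) mpoly set) \<subseteq> monomial_span V"
  show "U \<subseteq> V"
  proof
    fix m assume "m \<in> U"
    then have "(Poly_Mapping.single m 1 :: ('e, 'k) mpoly) \<in> monomial_span V"
      using le single_in_monomial_span by blast
    then show "m \<in> V" by (simp add: single_in_monomial_span)
  qed
qed (rule monomial_span_mono)

lemma monomial_span_add: "p \<in> monomial_span U \<Longrightarrow> q \<in> monomial_span U \<Longrightarrow> p + q \<in> monomial_span U"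
  using Poly_Mapping.keys_add[of p q] by (auto simp: monomial_span_def)

lemma monomial_span_least:
  fixes J :: "('e, 'k::field) mpoly set"
  assumes "0 \<in> J" and add: "\<And>p q. p \<in> J \<Longrightarrow> q \<in> J \<Longrightarrow> p + q \<in> J"
    and single: "\<And>m c. m \<in> U \<Longrightarrow> Poly_Mapping.single m c \<in> J"
  shows "monomial_span U \<subseteq> J"
proof
  fix p :: "('e, 'k) mpoly" assume "p \<in> monomial_span U"
  then have K: "Poly_Mapping.keys p \<subseteq> U" by (simp add: monomial_span_def)
  have "(\<Sum>m\<in>F. Poly_Mapping.single m (Poly_Mapping.lookup p m)) \<in> J" if "finite F" "F \<subseteq> U" for F
    using that by induction (auto intro: assms)
  from this[OF finite_keys K] show "p \<in> J" using poly_mapping_sum_singles[of p] by simp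
qed

text \<open>\<open>ideal_prod\<close> is the closure of the products under addition, so exponent
  sets simply add elementwise, whether or not the factors are ideals.\<close>

lemma ideal_prod_monomial_span:
  "ideal_prod (mpoly_ring E) (monomial_span U) (monomial_span V :: ('e, 'k::field) mpoly set)
    = monomial_span {u + v |u v. u \<in> U \<and> v \<in> V}" (is "?P = monomial_span ?W")
proof
  show "?P \<subseteq> monomial_span ?W"
  proof
    fix p assume "p \<in> ?P"
    then show "p \<in> monomial_span ?W"
    proof induction
      case (prod i j)
      then show ?case using keys_mult[of i j] unfolding monomial_span_def by auto blast
    qed (simp add: monomial_span_add)
  qed
  show "monomial_span ?W \<subseteq> ?P"
  proof (rule monomial_span_least)
    have "(0 :: ('e, 'k) mpoly) \<in> monomial_span U" "(0 :: ('e, 'k) mpoly) \<in> monomial_span V"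
      by (simp_all add: monomial_span_def)
    from ideal_prod.prod[OF this, of "mpoly_ring E"] show "0 \<in> ?P" by simp
    show "p + q \<in> ?P" if "p \<in> ?P" "q \<in> ?P" for p q
      using ideal_prod.sum[OF that] by simp
    fix m :: "'e \<Rightarrow>\<^sub>0 nat" and c :: 'k assume "m \<in> ?W"
    then obtain u v where uv: "u \<in> U" "v \<in> V" "m = u + v" by blast
    have "Poly_Mapping.single u c \<in> monomial_span U"
      "(Poly_Mapping.single v 1 :: ('e, 'k) mpoly) \<in> monomial_span V"
      using uv by (simp_all add: single_in_monomial_span)
    from ideal_prod.prod[OF this, of "mpoly_ring E"] show "Poly_Mapping.single m c \<in> ?P"
      by (simp add: uv(3) mult_single)
  qed
qed

text \<open>\<open>W\<close> is left open so that a closed form of the exponent sets can be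
  supplied: once for prime ideals generated by variables, once for facet ideals.\<close>

lemma ideal_power_monomial_span:
  fixes U :: "('e \<Rightarrow>\<^sub>0 nat) set"
  assumes "W 0 = exponents E" and "\<And>s. W (Suc s) = {u + v |u v. u \<in> W s \<and> v \<in> U}"
  shows "ideal_power (mpoly_ring E) (monomial_span U :: ('e, 'k::field) mpoly set) s = monomial_span (W s)"
  by (induction s) (simp_all add: assms carrier_mpoly_ring ideal_prod_monomial_span)

lemma ideal_monomial_span:
  fixes U :: "('e \<Rightarrow>\<^sub>0 nat) set"
  assumes U: "U \<subseteq> exponents E" and up: "\<And>u v. u \<in> U \<Longrightarrow> v \<in> exponents E \<Longrightarrow> u + v \<in> U"
  shows "ideal (monomial_span U :: ('e, 'k::field) mpoly set) (mpoly_ring E)"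
proof -
  interpret R: cring "mpoly_ring E :: ('e, 'k) mpoly ring" by (rule cring_mpoly_ring)
  let ?I = "monomial_span U :: ('e, 'k) mpoly set"
  have car: "?I \<subseteq> carrier (mpoly_ring E)"
    unfolding carrier_mpoly_ring by (rule monomial_span_mono[OF U])
  have neg: "\<ominus>\<^bsub>mpoly_ring E\<^esub> a = - a" if "a \<in> ?I" for a
  proof (rule R.minus_equality)
    show "- a \<in> carrier (mpoly_ring E)" using that car by (auto simp: mpoly_ring_def)
  qed (use that car in auto)
  have mult: "a * b \<in> ?I" if "a \<in> ?I" "b \<in> carrier (mpoly_ring E)" for a b
  proof -
    have "u + v \<in> U" if "u \<in> Poly_Mapping.keys a" "v \<in> Poly_Mapping.keys b" for u v
      using that \<open>a \<in> ?I\<close> \<open>b \<in> carrier (mpoly_ring E)\<close> up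
      unfolding carrier_mpoly_ring monomial_span_def by blast
    then show ?thesis using keys_mult[of a b] unfolding monomial_span_def by auto
  qed
  have "subgroup ?I (add_monoid (mpoly_ring E))"
  proof (rule R.add.subgroupI)
    show "?I \<subseteq> carrier (mpoly_ring E)" by (rule car)
    show "?I \<noteq> {}" unfolding monomial_span_def by (metis (mono_tags) empty_subsetI empty_iff keys_zero mem_Collect_eq)
    show "\<ominus>\<^bsub>mpoly_ring E\<^esub> a \<in> ?I" if "a \<in> ?I" for a
      using neg[OF that] that by (simp add: monomial_span_def)
  qed (simp add: monomial_span_add)
  then show ?thesis
    by (intro idealI) (use mult in \<open>auto simp: mult.commute R.ring_axioms\<close>)
qed

section \<open>Prime ideals generated by variables, and their powers\<close>

text \<open>The ideal generated by the variables of \<open>C\<close>, written through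
  \<open>weight\<close> so that its powers arise by replacing 1 with the exponent.\<close>

definition variable_ideal :: "'e set \<Rightarrow> 'e set \<Rightarrow> ('e, 'k::field) mpoly set" where
  "variable_ideal E C = monomial_span {m \<in> exponents E. 1 \<le> weight C m}"

lemma weight_pos_iff: "finite C \<Longrightarrow> 1 \<le> weight C m \<longleftrightarrow> (\<exists>e\<in>C. Poly_Mapping.lookup m e \<noteq> 0)"
  unfolding weight_def by (simp add: Suc_le_eq sum_pos2 flip: neq0_conv)

lemma ideal_variable_ideal: "ideal (variable_ideal E C :: ('e, 'k::field) mpoly set) (mpoly_ring E)"
  unfolding variable_ideal_def
  by (rule ideal_monomial_span) (auto simp: exponents_add weight_add)

text \<open>The index type need not be linearly ordered, so a monomial order has to be pulled back along an
  enumeration of the variables.\<close>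

lemma ex_monomial_order:
  fixes E :: "'e set"
  assumes "finite E"
  obtains \<phi> :: "('e \<Rightarrow>\<^sub>0 nat) \<Rightarrow> (nat \<Rightarrow>\<^sub>0 nat)"
  where "\<And>u v. \<phi> (u + v) = \<phi> u + \<phi> v" "inj_on \<phi> (exponents E)"
proof -
  obtain h :: "'e \<Rightarrow> nat" where h: "inj_on h E" using finite_imp_inj_to_nat_seg[OF assms] by blast
  define \<phi> where "\<phi> m = (\<Sum>e\<in>E. Poly_Mapping.single (h e) (Poly_Mapping.lookup m e))"
    for m :: "'e \<Rightarrow>\<^sub>0 nat"
  have look: "Poly_Mapping.lookup (\<phi> m) (h e) = Poly_Mapping.lookup m e" if e: "e \<in> E" for m e
  proof -
    have "Poly_Mapping.lookup (\<phi> m) (h e) = (\<Sum>i\<in>E. if i = e then Poly_Mapping.lookup m e else 0)"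
      unfolding \<phi>_def lookup_sum
      by (intro sum.cong) (use e h in \<open>auto simp: lookup_single when_def inj_on_eq_iff\<close>)
    then show ?thesis using e assms by simp
  qed
  have "\<phi> (u + v) = \<phi> u + \<phi> v" for u v
    by (simp add: \<phi>_def lookup_add single_add sum.distrib)
  moreover have "inj_on \<phi> (exponents E)"
  proof (rule inj_onI, rule poly_mapping_eqI)
    fix u v e assume u: "u \<in> exponents E" and v: "v \<in> exponents E" and eq: "\<phi> u = \<phi> v"
    show "Poly_Mapping.lookup u e = Poly_Mapping.lookup v e"
    proof (cases "e \<in> E")
      case True
      then show ?thesis using look eq by metis
    next
      case False
      then have "e \<notin> Poly_Mapping.keys u" "e \<notin> Poly_Mapping.keys v" using u v by (auto simp: exponents_def)
      then show ?thesis by (simp add: in_keys_iff)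
    qed
  qed
  ultimately show ?thesis by (rule that)
qed

text \<open>If \<open>p\<close> and \<open>q\<close> lie outside, the product of their leading monomials among those free of variables
  from \<open>C\<close> occurs in \<open>p * q\<close>.\<close>

lemma primeideal_variable_ideal:
  fixes E :: "'e set"
  assumes E: "finite E" and C: "C \<subseteq> E"
  shows "primeideal (variable_ideal E C :: ('e, 'k::field) mpoly set) (mpoly_ring E)"
proof (rule primeidealI[OF ideal_variable_ideal cring_mpoly_ring])
  have "(1 :: ('e, 'k) mpoly) \<in> carrier (mpoly_ring E)" by (simp add: mpoly_ring_def)
  moreover have "(1 :: ('e, 'k) mpoly) \<notin> variable_ideal E C"
    by (simp add: variable_ideal_def monomial_span_def weight_def)
  ultimately show "carrier (mpoly_ring E) \<noteq> (variable_ideal E C :: ('e, 'k) mpoly set)" by blast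
next
  fix p q :: "('e, 'k) mpoly"
  assume p: "p \<in> carrier (mpoly_ring E)" and q: "q \<in> carrier (mpoly_ring E)"
    and pq: "p \<otimes>\<^bsub>mpoly_ring E\<^esub> q \<in> variable_ideal E C"
  show "p \<in> variable_ideal E C \<or> q \<in> variable_ideal E C"
  proof (rule ccontr)
    assume no: "\<not> ?thesis"
    obtain \<phi> :: "('e \<Rightarrow>\<^sub>0 nat) \<Rightarrow> (nat \<Rightarrow>\<^sub>0 nat)"
      where add: "\<And>u v. \<phi> (u + v) = \<phi> u + \<phi> v" and inj: "inj_on \<phi> (exponents E)"
      using ex_monomial_order[OF E] by blast
    have lead: "\<exists>a\<in>Poly_Mapping.keys r. weight C a = 0 \<and>
        (\<forall>m\<in>Poly_Mapping.keys r. weight C m = 0 \<longrightarrow> \<phi> m \<le> \<phi> a)"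
      if r: "r \<in> carrier (mpoly_ring E)" "r \<notin> variable_ideal E C" for r :: "('e, 'k) mpoly"
    proof -
      let ?K = "{m \<in> Poly_Mapping.keys r. weight C m = 0}"
      have "?K \<noteq> {}"
        using r unfolding carrier_mpoly_ring variable_ideal_def monomial_span_def
        by (auto simp: Suc_le_eq)
      then have "Max (\<phi> ` ?K) \<in> \<phi> ` ?K" by (intro Max_in) auto
      then obtain a where a: "a \<in> ?K" "\<phi> a = Max (\<phi> ` ?K)" by auto
      have "\<phi> m \<le> \<phi> a" if "m \<in> ?K" for m
        unfolding a(2) by (rule Max_ge) (use that in auto)
      then show ?thesis using a(1) by blast
    qed
    obtain a where a: "a \<in> Poly_Mapping.keys p" "weight C a = 0"
      "\<And>m. m \<in> Poly_Mapping.keys p \<Longrightarrow> weight C m = 0 \<Longrightarrow> \<phi> m \<le> \<phi> a"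
      using lead[OF p] no by blast
    obtain b where b: "b \<in> Poly_Mapping.keys q" "weight C b = 0"
      "\<And>m. m \<in> Poly_Mapping.keys q \<Longrightarrow> weight C m = 0 \<Longrightarrow> \<phi> m \<le> \<phi> b"
      using lead[OF q] no by blast
    \<comment> \<open>Only the pair \<open>(a, b)\<close> contributes to this coefficient: since
      \<open>a + b\<close> has no variable from \<open>C\<close>, neither have \<open>u\<close> and
      \<open>v\<close>, so both are bounded by the leading monomials, and equal sums force
      equality.\<close>
    have unique: "u = a \<and> v = b"
      if u: "u \<in> Poly_Mapping.keys p" and v: "v \<in> Poly_Mapping.keys q" and eq: "u + v = a + b" for u v
    proof -
      have "weight C u + weight C v = 0" using eq a(2) b(2) by (metis weight_add add_0)
      then have le: "\<phi> u \<le> \<phi> a" "\<phi> v \<le> \<phi> b" using a(3)[OF u] b(3)[OF v] by simp_all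
      have sum: "\<phi> u + \<phi> v = \<phi> a + \<phi> b" using eq add by metis
      have "\<phi> u = \<phi> a"
      proof (rule ccontr)
        assume "\<phi> u \<noteq> \<phi> a"
        then have "\<phi> u + \<phi> v < \<phi> a + \<phi> b" using le by (intro add_less_le_mono) auto
        then show False using sum by simp
      qed
      moreover from this have "\<phi> v = \<phi> b" using sum by simp
      moreover have "{u, a} \<subseteq> exponents E" "{v, b} \<subseteq> exponents E"
        using u v a(1) b(1) p q unfolding carrier_mpoly_ring monomial_span_def by blast+
      ultimately show ?thesis using inj by (simp add: inj_on_eq_iff)
    qed
    let ?s = "\<lambda>r m. Poly_Mapping.single m (Poly_Mapping.lookup r m)"
    have "p * q = (\<Sum>u\<in>Poly_Mapping.keys p. ?s p u) * (\<Sum>v\<in>Poly_Mapping.keys q. ?s q v)"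
      using poly_mapping_sum_singles[of p] poly_mapping_sum_singles[of q] by simp
    also have "\<dots> = (\<Sum>u\<in>Poly_Mapping.keys p. \<Sum>v\<in>Poly_Mapping.keys q.
        Poly_Mapping.single (u + v) (Poly_Mapping.lookup p u * Poly_Mapping.lookup q v))"
      by (simp add: sum_product mult_single)
    finally have "Poly_Mapping.lookup (p * q) (a + b) = (\<Sum>u\<in>Poly_Mapping.keys p. \<Sum>v\<in>Poly_Mapping.keys q.
        (Poly_Mapping.lookup p u * Poly_Mapping.lookup q v when u + v = a + b))"
      by (simp add: lookup_sum lookup_single)
    also have "\<dots> = (\<Sum>u\<in>Poly_Mapping.keys p. \<Sum>v\<in>Poly_Mapping.keys q.
        (if v = b then if u = a then Poly_Mapping.lookup p a * Poly_Mapping.lookup q b else 0 else 0))"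
      by (intro sum.cong refl) (use unique in \<open>auto simp: when_def\<close>)
    also have "\<dots> = Poly_Mapping.lookup p a * Poly_Mapping.lookup q b"
      using a(1) b(1) by simp
    also have "\<dots> \<noteq> 0" using a(1) b(1) by (simp add: in_keys_iff)
    finally have "a + b \<in> Poly_Mapping.keys (p * q)" by (simp add: in_keys_iff)
    then have "1 \<le> weight C (a + b)" using pq unfolding variable_ideal_def monomial_span_def by auto
    then show False using a(2) b(2) by (simp add: weight_add)
  qed
qed

lemma minus_exponent_add_cancel:
  fixes m :: "'e \<Rightarrow>\<^sub>0 nat"
  assumes "\<And>e. Poly_Mapping.lookup v e \<le> Poly_Mapping.lookup m e"
  shows "(m - v) + v = m"
  by (rule poly_mapping_eqI) (simp add: lookup_add lookup_minus assms)

text \<open>A monomial of weight at least \<open>s + 1\<close> contains a variable of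
  \<open>C\<close>; dividing by it lowers the weight by exactly one.\<close>

lemma ideal_power_variable_ideal:
  fixes E :: "'e set"
  assumes E: "finite E" and C: "C \<subseteq> E"
  shows "ideal_power (mpoly_ring E) (variable_ideal E C :: ('e, 'k::field) mpoly set) s
    = monomial_span {m \<in> exponents E. s \<le> weight C m}"
  unfolding variable_ideal_def
proof (rule ideal_power_monomial_span[where W = "\<lambda>s. {m \<in> exponents E. s \<le> weight C m}"])
  fix s
  have fC: "finite C" using E C finite_subset by metis
  show "{m \<in> exponents E. Suc s \<le> weight C m} = {u + v |u v.
    u \<in> {m \<in> exponents E. s \<le> weight C m} \<and> v \<in> {m \<in> exponents E. 1 \<le> weight C m}}" (is "?L = ?R")
  proof
    show "?L \<subseteq> ?R"
    proof
      fix m assume m: "m \<in> ?L"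
      then obtain e where e: "e \<in> C" "Poly_Mapping.lookup m e \<noteq> 0"
        using weight_pos_iff[OF fC, of m] by auto
      define v where "v = Poly_Mapping.single e (1::nat)"
      have split: "(m - v) + v = m"
        by (rule minus_exponent_add_cancel) (use e in \<open>auto simp: v_def lookup_single when_def Suc_le_eq\<close>)
      have v: "weight C v = 1" unfolding v_def using e(1) weight_single[OF fC] by simp
      have "weight C (m - v) + 1 = weight C m" using weight_add[of C "m - v" v] split v by simp
      then have "s \<le> weight C (m - v)" using m by simp
      moreover have "m - v \<in> exponents E" "v \<in> exponents E"
        using m split exponents_add[of "m - v" v E] by auto
      ultimately show "m \<in> ?R" using v split by force
    qed
    show "?R \<subseteq> ?L" by (auto simp: exponents_add weight_add)
  qed
qed simp

section \<open>Facet ideals and their powers\<close>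

definition indicator_exp :: "'e set \<Rightarrow> ('e \<Rightarrow>\<^sub>0 nat)" where
  "indicator_exp B = (\<Sum>e\<in>B. Poly_Mapping.single e 1)"

lemma lookup_indicator_exp:
  assumes "finite B"
  shows "Poly_Mapping.lookup (indicator_exp B) e = (if e \<in> B then 1 else 0)"
proof -
  have "Poly_Mapping.lookup (indicator_exp B) e = (\<Sum>i\<in>B. if i = e then 1 else 0)"
    unfolding indicator_exp_def lookup_sum by (intro sum.cong) (auto simp: lookup_single when_def)
  then show ?thesis using assms by simp
qed

lemma prod_mpoly_var:
  "finite B \<Longrightarrow> (\<Prod>e\<in>B. mpoly_var e) = (Poly_Mapping.single (indicator_exp B) 1 :: ('e, 'k::field) mpoly)"
  by (induction rule: finite_induct) (simp_all add: indicator_exp_def mpoly_var_def mult_single)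

lemma mpoly_var_in_variable_ideal:
  assumes "finite E" "C \<subseteq> E" "e \<in> E"
  shows "(mpoly_var e :: ('e, 'k::field) mpoly) \<in> variable_ideal E C \<longleftrightarrow> e \<in> C"
proof -
  have "finite C" using assms finite_subset by metis
  then show ?thesis
    unfolding variable_ideal_def mpoly_var_def single_in_monomial_span
    using assms(3) by (simp add: weight_single exponents_single)
qed

lemma variable_ideal_subset:
  fixes Q :: "('e, 'k::field) mpoly set"
  assumes E: "finite E" and C: "C \<subseteq> E" and Q: "ideal Q (mpoly_ring E)"
    and vars: "\<And>e. e \<in> C \<Longrightarrow> mpoly_var e \<in> Q"
  shows "variable_ideal E C \<subseteq> Q"
  unfolding variable_ideal_def
proof (rule monomial_span_least)
  interpret ideal Q "mpoly_ring E" by (rule Q)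
  show "0 \<in> Q" using additive_subgroup.zero_closed[OF additive_subgroup_axioms] by simp
  show "p + q \<in> Q" if "p \<in> Q" "q \<in> Q" for p q using additive_subgroup.a_closed[OF additive_subgroup_axioms that] by simp
  fix m :: "'e \<Rightarrow>\<^sub>0 nat" and c :: 'k
  have fC: "finite C" using E C finite_subset by metis
  assume m: "m \<in> {m \<in> exponents E. 1 \<le> weight C m}"
  then obtain e where e: "e \<in> C" "Poly_Mapping.lookup m e \<noteq> 0"
    using weight_pos_iff[OF fC] by blast
  let ?v = "Poly_Mapping.single e (1::nat)"
  have split: "(m - ?v) + ?v = m"
    by (rule minus_exponent_add_cancel) (use e in \<open>auto simp: lookup_single when_def Suc_le_eq\<close>)
  have "m - ?v \<in> exponents E" using m split exponents_add[of "m - ?v" ?v E] by auto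
  then have "Poly_Mapping.single (m - ?v) c \<in> carrier (mpoly_ring E)"
    by (simp add: carrier_mpoly_ring single_in_monomial_span)
  from I_l_closed[OF vars[OF e(1)] this] show "Poly_Mapping.single m c \<in> Q"
    using split by (simp add: mpoly_var_def mult_single)
qed

lemma facet_ideal_eq:
  fixes E :: "'e set"
  assumes E: "finite E" and sub: "\<B> \<subseteq> Pow E"
  shows "facet_ideal TYPE('k::field) E \<B>
    = monomial_span {m \<in> exponents E. \<exists>B\<in>\<B>. \<forall>e\<in>B. 1 \<le> Poly_Mapping.lookup m e}" (is "_ = monomial_span ?U")
proof
  interpret R: cring "mpoly_ring E :: ('e, 'k) mpoly ring" by (rule cring_mpoly_ring)
  let ?G = "(\<lambda>B. \<Prod>e\<in>B. mpoly_var e) ` \<B> :: ('e, 'k) mpoly set"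
  have subB: "B \<subseteq> E" if "B \<in> \<B>" for B using sub that by blast
  have fin: "finite B" if "B \<in> \<B>" for B using subB[OF that] E finite_subset by metis
  have ind: "indicator_exp B \<in> ?U" if B: "B \<in> \<B>" for B
    using subB[OF B] B by (auto simp: exponents_def in_keys_iff lookup_indicator_exp[OF fin[OF B]]
        intro!: bexI[of _ B] split: if_splits)
  have G: "?G \<subseteq> monomial_span ?U"
  proof (clarify)
    fix B assume B: "B \<in> \<B>"
    show "(\<Prod>e\<in>B. mpoly_var e) \<in> monomial_span ?U"
      unfolding prod_mpoly_var[OF fin[OF B]] single_in_monomial_span using ind[OF B] by blast
  qed
  have U: "?U \<subseteq> exponents E" by blast
  have "ideal (monomial_span ?U :: ('e, 'k) mpoly set) (mpoly_ring E)"
  proof (rule ideal_monomial_span[OF U])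
    fix u v assume u: "u \<in> ?U" and v: "v \<in> exponents E"
    then obtain B where "B \<in> \<B>" "\<forall>e\<in>B. 1 \<le> Poly_Mapping.lookup u e" by blast
    then have "B \<in> \<B>" "\<forall>e\<in>B. 1 \<le> Poly_Mapping.lookup (u + v) e"
      by (simp_all add: lookup_add trans_le_add1)
    then show "u + v \<in> ?U" using u v exponents_add by blast
  qed
  then show "facet_ideal TYPE('k) E \<B> \<subseteq> monomial_span ?U"
    unfolding facet_ideal_def by (rule R.genideal_minimal) (rule G)
  have Gc: "?G \<subseteq> carrier (mpoly_ring E)"
    unfolding carrier_mpoly_ring using G monomial_span_mono[OF U] by blast
  interpret J: ideal "facet_ideal TYPE('k) E \<B>" "mpoly_ring E"
    unfolding facet_ideal_def by (rule R.genideal_ideal[OF Gc])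
  show "monomial_span ?U \<subseteq> facet_ideal TYPE('k) E \<B>"
  proof (rule monomial_span_least)
    show "0 \<in> facet_ideal TYPE('k) E \<B>"
      using additive_subgroup.zero_closed[OF J.additive_subgroup_axioms] by simp
    show "p + q \<in> facet_ideal TYPE('k) E \<B>"
      if "p \<in> facet_ideal TYPE('k) E \<B>" "q \<in> facet_ideal TYPE('k) E \<B>" for p q
      using additive_subgroup.a_closed[OF J.additive_subgroup_axioms that] by simp
    fix m and c :: 'k assume m: "m \<in> ?U"
    then obtain B where B: "B \<in> \<B>" "\<forall>e\<in>B. 1 \<le> Poly_Mapping.lookup m e" by blast
    let ?v = "indicator_exp B"
    have split: "(m - ?v) + ?v = m"
      by (rule minus_exponent_add_cancel) (use B fin[OF B(1)] in \<open>simp add: lookup_indicator_exp\<close>)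
    have "m - ?v \<in> exponents E" using m split exponents_add[of "m - ?v" ?v E] by auto
    then have 1: "Poly_Mapping.single (m - ?v) c \<in> carrier (mpoly_ring E)"
      by (simp add: carrier_mpoly_ring single_in_monomial_span)
    have "Poly_Mapping.single ?v 1 \<in> facet_ideal TYPE('k) E \<B>"
      unfolding facet_ideal_def prod_mpoly_var[OF fin[OF B(1)], symmetric]
      using R.genideal_self[OF Gc] B(1) by blast
    from J.I_l_closed[OF this 1] show "Poly_Mapping.single m c \<in> facet_ideal TYPE('k) E \<B>"
      by (simp add: mult_single split)
  qed
qed

text \<open>\<beta> lists the bases in a product of \<open>N\<close> generators, and the cardinality
  is the exponent of the variable \<open>e\<close> in that product. This is the form in which
  \<open>base_packing\<close> delivers its result.\<close>

lemma ideal_power_facet_ideal: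
  fixes E :: "'e set"
  assumes E: "finite E" and sub: "\<B> \<subseteq> Pow E"
  shows "ideal_power (mpoly_ring E) (facet_ideal TYPE('k::field) E \<B>) N
    = monomial_span {m \<in> exponents E. \<exists>\<beta>. (\<forall>i<N. \<beta> i \<in> \<B>) \<and>
        (\<forall>e\<in>E. card {i. i < N \<and> e \<in> \<beta> i} \<le> Poly_Mapping.lookup m e)}"
proof -
  have subB: "B \<subseteq> E" if "B \<in> \<B>" for B using sub that by blast
  define W where "W N = {m \<in> exponents E. \<exists>\<beta>. (\<forall>i<N. \<beta> i \<in> \<B>) \<and>
        (\<forall>e\<in>E. card {i. i < N \<and> e \<in> \<beta> i} \<le> Poly_Mapping.lookup m e)}" for N :: nat
  have count: "card {i. i < Suc N \<and> e \<in> \<beta> i} = card {i. i < N \<and> e \<in> \<beta> i} + (if e \<in> \<beta> N then 1 else 0)"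
    for \<beta> :: "nat \<Rightarrow> 'e set" and e N
  proof -
    have "{i. i < Suc N \<and> e \<in> \<beta> i} = {i. i < N \<and> e \<in> \<beta> i} \<union> (if e \<in> \<beta> N then {N} else {})"
      by (auto simp: less_Suc_eq)
    then show ?thesis by simp
  qed
  have WSuc: "W (Suc N) = {u + v |u v. u \<in> W N \<and>
      v \<in> {m \<in> exponents E. \<exists>B\<in>\<B>. \<forall>e\<in>B. 1 \<le> Poly_Mapping.lookup m e}}" (is "_ = ?R") for N
  proof
    show "W (Suc N) \<subseteq> ?R"
    proof
      fix m assume "m \<in> W (Suc N)"
      then obtain \<beta> where mE: "m \<in> exponents E" and \<beta>: "\<forall>i<Suc N. \<beta> i \<in> \<B>"
        "\<forall>e\<in>E. card {i. i < Suc N \<and> e \<in> \<beta> i} \<le> Poly_Mapping.lookup m e" unfolding W_def by blast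
      have B: "\<beta> N \<in> \<B>" using \<beta>(1) by simp
      have fB: "finite (\<beta> N)" using subB[OF B] E finite_subset by metis
      let ?v = "indicator_exp (\<beta> N)"
      have le: "card {i. i < N \<and> e \<in> \<beta> i} + Poly_Mapping.lookup ?v e \<le> Poly_Mapping.lookup m e"
        if "e \<in> E" for e
        using \<beta>(2) that unfolding count lookup_indicator_exp[OF fB] by blast
      have "Poly_Mapping.lookup ?v e \<le> Poly_Mapping.lookup m e" for e
        using le[of e] subB[OF B] by (cases "e \<in> E") (auto simp: lookup_indicator_exp[OF fB])
      then have split: "(m - ?v) + ?v = m" by (rule minus_exponent_add_cancel)
      have ex: "m - ?v \<in> exponents E" "?v \<in> exponents E"
        using mE split exponents_add[of "m - ?v" ?v E] by auto
      have "card {i. i < N \<and> e \<in> \<beta> i} \<le> Poly_Mapping.lookup (m - ?v) e" if "e \<in> E" for e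
        using le[OF that] unfolding lookup_minus by simp
      moreover have "\<forall>i<N. \<beta> i \<in> \<B>" using \<beta>(1) by simp
      ultimately have "m - ?v \<in> W N" unfolding W_def using ex(1) by blast
      moreover have "\<forall>e\<in>\<beta> N. 1 \<le> Poly_Mapping.lookup ?v e" by (simp add: lookup_indicator_exp[OF fB])
      then have "?v \<in> {m \<in> exponents E. \<exists>B\<in>\<B>. \<forall>e\<in>B. 1 \<le> Poly_Mapping.lookup m e}"
        using ex(2) B by blast
      ultimately show "m \<in> ?R" using split[symmetric] by blast
    qed
    show "?R \<subseteq> W (Suc N)"
    proof
      fix m assume "m \<in> ?R"
      then obtain u v B \<beta> where m: "m = u + v" "u \<in> exponents E" "v \<in> exponents E" and B: "B \<in> \<B>"
        "\<forall>e\<in>B. 1 \<le> Poly_Mapping.lookup v e" and \<beta>: "\<forall>i<N. \<beta> i \<in> \<B>"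
        "\<forall>e\<in>E. card {i. i < N \<and> e \<in> \<beta> i} \<le> Poly_Mapping.lookup u e" unfolding W_def by blast
      define \<beta>' where "\<beta>' = \<beta>(N := B)"
      have "card {i. i < Suc N \<and> e \<in> \<beta>' i} \<le> Poly_Mapping.lookup m e" if e: "e \<in> E" for e
      proof -
        have "{i. i < N \<and> e \<in> \<beta>' i} = {i. i < N \<and> e \<in> \<beta> i}" unfolding \<beta>'_def by auto
        moreover have "\<beta>' N = B" unfolding \<beta>'_def by simp
        moreover have "(if e \<in> B then 1 else 0) \<le> Poly_Mapping.lookup v e" using B(2) by simp
        ultimately show ?thesis using \<beta>(2) e unfolding count m(1) lookup_add by (simp add: add_mono)
      qed
      moreover have "\<forall>i<Suc N. \<beta>' i \<in> \<B>" unfolding \<beta>'_def using \<beta>(1) B(1) by (simp add: less_Suc_eq)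
      ultimately show "m \<in> W (Suc N)" unfolding W_def using m exponents_add by blast
    qed
  qed
  have "ideal_power (mpoly_ring E) (facet_ideal TYPE('k) E \<B>) N = monomial_span (W N)"
    unfolding facet_ideal_eq[OF E sub]
    by (rule ideal_power_monomial_span[where W = W, OF _ WSuc]) (simp add: W_def)
  then show ?thesis unfolding W_def .
qed

section \<open>Minimal primes and symbolic powers\<close>

lemma facet_ideal_subset_variable_ideal:
  fixes E :: "'e set"
  assumes E: "finite E" and sub: "\<B> \<subseteq> Pow E" and C: "transversal E \<B> C"
  shows "facet_ideal TYPE('k::field) E \<B> \<subseteq> variable_ideal E C"
  unfolding facet_ideal_eq[OF E sub] variable_ideal_def
proof (rule monomial_span_mono, clarify)
  fix m :: "'e \<Rightarrow>\<^sub>0 nat" and B assume B: "B \<in> \<B>" "\<forall>e\<in>B. 1 \<le> Poly_Mapping.lookup m e"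
  have fC: "finite C" using C E finite_subset unfolding transversal_def by metis
  obtain e where "e \<in> C" "e \<in> B" using C B(1) unfolding transversal_def by blast
  then show "1 \<le> weight C m" using B(2) weight_pos_iff[OF fC, of m] by fastforce
qed

text \<open>A prime that contains the product of the variables of a basis contains one of them; the
  empty product is excluded, being 1.\<close>

lemma transversal_vars_in_prime:
  fixes Q :: "('e, 'k::field) mpoly set"
  assumes E: "finite E" and sub: "\<B> \<subseteq> Pow E"
    and Q: "primeideal Q (mpoly_ring E)" and IQ: "facet_ideal TYPE('k) E \<B> \<subseteq> Q"
  shows "transversal E \<B> {e \<in> E. mpoly_var e \<in> Q}"
proof -
  interpret primeideal Q "mpoly_ring E" by (rule Q)
  have subB: "B \<subseteq> E" if "B \<in> \<B>" for B using sub that by blast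
  have var: "(mpoly_var e :: ('e, 'k) mpoly) \<in> carrier (mpoly_ring E)" if "e \<in> E" for e
    using that by (simp add: mpoly_var_def carrier_mpoly_ring single_in_monomial_span exponents_single)
  have "\<exists>e\<in>B. mpoly_var e \<in> Q" if "finite B" "B \<subseteq> E" "(\<Prod>e\<in>B. mpoly_var e) \<in> Q" for B
    using that
  proof (induction rule: finite_induct)
    case empty
    then have "\<one>\<^bsub>mpoly_ring E\<^esub> \<in> Q" by simp
    then show ?case using one_imp_carrier I_notcarr by blast
  next
    case (insert e B)
    have carrier_prod: "(\<Prod>e\<in>B. mpoly_var e) \<in> (carrier (mpoly_ring E) :: ('e, 'k) mpoly set)"
      using insert(1) insert.prems(1)
    proof (induction rule: finite_induct)
      case empty
      show ?case by (simp add: mpoly_ring_def)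
    qed (simp add: mpoly_ring_mult_closed var)
    have "mpoly_var e \<otimes>\<^bsub>mpoly_ring E\<^esub> (\<Prod>e\<in>B. mpoly_var e) \<in> Q" using insert by simp
    then show ?case using I_prime[OF var carrier_prod] insert by auto
  qed
  moreover have "(\<Prod>e\<in>B. mpoly_var e) \<in> Q" if B: "B \<in> \<B>" for B
  proof -
    have fB: "finite B" using subB[OF B] E finite_subset by metis
    have "(\<Prod>e\<in>B. mpoly_var e) \<in> facet_ideal TYPE('k) E \<B>"
      unfolding facet_ideal_eq[OF E sub] prod_mpoly_var[OF fB] single_in_monomial_span
      using subB[OF B] B by (auto simp: exponents_def in_keys_iff lookup_indicator_exp[OF fB]
        intro!: bexI[of _ B] split: if_splits)
    then show ?thesis using IQ by blast
  qed
  ultimately show ?thesis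
    unfolding transversal_def using subB E finite_subset by (smt (verit) disjoint_iff mem_Collect_eq subset_iff)
qed

lemma minimal_transversal_exists:
  fixes E :: "'e set"
  assumes E: "finite E" and C: "transversal E \<B> C"
  obtains C' where "C' \<subseteq> C" "transversal E \<B> C'" "\<And>X. X \<subset> C' \<Longrightarrow> \<not> transversal E \<B> X"
proof -
  obtain C' where C': "C' \<subseteq> C \<and> transversal E \<B> C'"
    and min: "\<And>X. X \<subseteq> C \<and> transversal E \<B> X \<Longrightarrow> card C' \<le> card X"
    using ex_has_least_nat[of "\<lambda>X. X \<subseteq> C \<and> transversal E \<B> X" C card] C by blast
  have "finite C'" using C' E finite_subset unfolding transversal_def by metis
  have "\<not> transversal E \<B> X" if X: "X \<subset> C'" for X
  proof
    assume "transversal E \<B> X"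
    then have "card C' \<le> card X" using min X C' by blast
    moreover have "card X < card C'" by (rule psubset_card_mono[OF \<open>finite C'\<close> X])
    ultimately show False by simp
  qed
  then show ?thesis using that C' by blast
qed

text \<open>Every prime above the facet ideal contains \<open>variable_ideal E C\<close> for a
  minimal transversal \<open>C\<close>. Minimality passes between \<open>C\<close> and this ideal
  because the variables it contains are exactly those of \<open>C\<close>.\<close>

lemma minimal_primes_facet_ideal:
  fixes E :: "'e set"
  assumes E: "finite E" and sub: "\<B> \<subseteq> Pow E"
  shows "minimal_primes (mpoly_ring E) (facet_ideal TYPE('k::field) E \<B>)
    = variable_ideal E ` {C. transversal E \<B> C \<and> (\<forall>X. X \<subset> C \<longrightarrow> \<not> transversal E \<B> X)}" (is "?M = ?V")
proof -
  let ?I = "facet_ideal TYPE('k) E \<B>"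
  have prime: "primeideal (variable_ideal E C :: ('e, 'k) mpoly set) (mpoly_ring E) \<and> ?I \<subseteq> variable_ideal E C"
    if "transversal E \<B> C" for C
    using that primeideal_variable_ideal[OF E] facet_ideal_subset_variable_ideal[OF E sub that]
    unfolding transversal_def by blast
  have below: "\<exists>C'. transversal E \<B> C' \<and> (\<forall>X. X \<subset> C' \<longrightarrow> \<not> transversal E \<B> X) \<and>
      C' \<subseteq> {e \<in> E. mpoly_var e \<in> Q} \<and> variable_ideal E C' \<subseteq> Q"
    if Q: "primeideal Q (mpoly_ring E)" "?I \<subseteq> Q" for Q
  proof -
    obtain C' where C': "C' \<subseteq> {e \<in> E. mpoly_var e \<in> Q}" "transversal E \<B> C'"
      "\<And>X. X \<subset> C' \<Longrightarrow> \<not> transversal E \<B> X"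
      using minimal_transversal_exists[OF E transversal_vars_in_prime[OF E sub Q]] by blast
    have "variable_ideal E C' \<subseteq> Q"
      by (rule variable_ideal_subset[OF E _ primeideal.axioms(1)[OF Q(1)]]) (use C'(1) in auto)
    then show ?thesis using C' by blast
  qed
  show ?thesis
  proof
    show "?M \<subseteq> ?V"
    proof
      fix P assume P: "P \<in> ?M"
      then have P': "primeideal P (mpoly_ring E)" "?I \<subseteq> P" unfolding minimal_primes_def by auto
      obtain C where C: "transversal E \<B> C" "\<forall>X. X \<subset> C \<longrightarrow> \<not> transversal E \<B> X" "variable_ideal E C \<subseteq> P"
        using below[OF P'] by blast
      have "variable_ideal E C = P" using P C(3) prime[OF C(1)] unfolding minimal_primes_def by blast
      then show "P \<in> ?V" using C by blast
    qed
    show "?V \<subseteq> ?M"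
    proof (clarify)
      fix C assume C: "transversal E \<B> C" "\<forall>X. X \<subset> C \<longrightarrow> \<not> transversal E \<B> X"
      have CE: "C \<subseteq> E" using C(1) unfolding transversal_def by blast
      have "Q = variable_ideal E C"
        if Q: "primeideal Q (mpoly_ring E)" "?I \<subseteq> Q" "Q \<subseteq> variable_ideal E C" for Q :: "('e, 'k) mpoly set"
      proof -
        obtain C' where C': "transversal E \<B> C'" "C' \<subseteq> {e \<in> E. mpoly_var e \<in> Q}" "variable_ideal E C' \<subseteq> Q"
          using below[OF Q(1,2)] by blast
        have "C' \<subseteq> C"
        proof
          fix e assume "e \<in> C'"
          then have "e \<in> E" "(mpoly_var e :: ('e, 'k) mpoly) \<in> variable_ideal E C" using C'(2) Q(3) by auto
          then show "e \<in> C" using mpoly_var_in_variable_ideal[OF E CE] by blast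
        qed
        then have "C' = C" using C(2) C'(1) by blast
        then show ?thesis using C'(3) Q(3) by blast
      qed
      then show "variable_ideal E C \<in> ?M" unfolding minimal_primes_def using prime[OF C(1)] by blast
    qed
  qed
qed

text \<open>Minimal primes only give conditions for minimal transversals. The others are implied, as
  \<open>weight\<close> grows with \<open>C\<close>; including them matches
  \<open>frac_cover\<close>.\<close>

lemma symbolic_power_facet_ideal:
  fixes E :: "'e set"
  assumes E: "finite E" and sub: "\<B> \<subseteq> Pow E"
  shows "symbolic_power (mpoly_ring E) (facet_ideal TYPE('k::field) E \<B>) s
    = monomial_span {m \<in> exponents E. \<forall>C. transversal E \<B> C \<longrightarrow> s \<le> weight C m}" (is "?L = monomial_span ?U")
proof
  have pow: "ideal_power (mpoly_ring E) (variable_ideal E C :: ('e, 'k) mpoly set) s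
    = monomial_span {m \<in> exponents E. s \<le> weight C m}" if "transversal E \<B> C" for C
    using that ideal_power_variable_ideal[OF E] unfolding transversal_def by blast
  show "monomial_span ?U \<subseteq> ?L"
    unfolding symbolic_power_def minimal_primes_facet_ideal[OF E sub]
    using pow by (auto simp: carrier_mpoly_ring monomial_span_def)
  show "?L \<subseteq> monomial_span ?U"
  proof
    fix p assume p: "p \<in> ?L"
    have "m \<in> ?U" if m: "m \<in> Poly_Mapping.keys p" for m
    proof -
      have "m \<in> exponents E" using p m unfolding symbolic_power_def carrier_mpoly_ring monomial_span_def by blast
      moreover have "s \<le> weight C m" if C: "transversal E \<B> C" for C
      proof -
        obtain C' where C': "C' \<subseteq> C" "transversal E \<B> C'" "\<And>X. X \<subset> C' \<Longrightarrow> \<not> transversal E \<B> X"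
          using minimal_transversal_exists[OF E C] by blast
        have "p \<in> ideal_power (mpoly_ring E) (variable_ideal E C') s"
          using p C' unfolding symbolic_power_def minimal_primes_facet_ideal[OF E sub] by blast
        then have "s \<le> weight C' m" unfolding pow[OF C'(2)] using m by (auto simp: monomial_span_def)
        also have "\<dots> \<le> weight C m"
          by (rule weight_mono[OF _ C'(1)]) (use C E finite_subset in \<open>auto simp: transversal_def\<close>)
        finally show ?thesis .
      qed
      ultimately show ?thesis by blast
    qed
    then show "p \<in> monomial_span ?U" unfolding monomial_span_def by blast
  qed
qed

lemma initial_degree_monomial_span:
  "initial_degree (monomial_span U :: ('e, 'k::field) mpoly set) = (LEAST d. \<exists>m\<in>U. exp_degree m = d)"
proof -
  have "(\<exists>p\<in>monomial_span U :: ('e, 'k) mpoly set. p \<noteq> 0 \<and> homogeneous d p) \<longleftrightarrow> (\<exists>m\<in>U. exp_degree m = d)" for d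
  proof
    assume "\<exists>p\<in>monomial_span U :: ('e, 'k) mpoly set. p \<noteq> 0 \<and> homogeneous d p"
    then obtain p :: "('e, 'k) mpoly" where p: "Poly_Mapping.keys p \<subseteq> U" "p \<noteq> 0" "homogeneous d p"
      unfolding monomial_span_def by blast
    then obtain m where "m \<in> Poly_Mapping.keys p" using keys_eq_empty by blast
    then show "\<exists>m\<in>U. exp_degree m = d" using p unfolding homogeneous_def by blast
  next
    assume "\<exists>m\<in>U. exp_degree m = d"
    then obtain m where "m \<in> U" "exp_degree m = d" by blast
    then show "\<exists>p\<in>monomial_span U :: ('e, 'k) mpoly set. p \<noteq> 0 \<and> homogeneous d p"
      by (intro bexI[of _ "Poly_Mapping.single m 1"])
        (auto simp: homogeneous_def single_in_monomial_span, metis lookup_single_eq lookup_zero zero_neq_one)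
  qed
  then show ?thesis unfolding initial_degree_def by simp
qed

section \<open>Waldschmidt constant and asymptotic resurgence\<close>

lemma indep_dual_iff:
  assumes "X \<subseteq> E"
  shows "indep (dual_bases E \<B>) X \<longleftrightarrow> \<not> transversal E \<B> X"
proof -
  have "X \<subseteq> E - B \<longleftrightarrow> X \<inter> B = {}" for B using assms by blast
  then show ?thesis using assms by (simp add: indep_def dual_bases_def transversal_def)
qed

text \<open>Paving speaks of circuits, the locale of all transversals: a transversal shrinks to a
  minimal one, which is a circuit of the dual, a matroid of rank \<open>card E - k\<close>.\<close>

lemma dual_paving_if_matroid:
  assumes M: "matroid E \<B>" and rank: "matroid_rank \<B> = k" and nu: "\<not> uniform E \<B>"
    and pav: "paving E (dual_bases E \<B>)" and nk: "2 * k \<le> card E"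
  shows "dual_paving E \<B> (card E - k) k"
proof
  note E = matroid_finite[OF M] and M' = matroid_dual[OF M]
  have cardB: "card B = k" if "B \<in> \<B>" for B using card_basis[OF M that] rank by simp
  have finB: "finite B" if "B \<in> \<B>" for B by (rule basis_finite[OF M that])
  have subB: "B \<subseteq> E" if "B \<in> \<B>" for B by (rule basis_subset[OF M that])
  show ne: "\<B> \<noteq> {}" using M by (simp add: matroid_def)
  show "finite E" "card E = card E - k + k" "k \<le> card E - k" using E nk by simp_all
  show "B \<subseteq> E" "card B = k" if "B \<in> \<B>" for B using subB[OF that] cardB[OF that] .
  \<comment> \<open>Non-uniformity rules out rank 0, where the empty set is the only basis.\<close>
  show "1 \<le> k"
  proof (rule ccontr)
    assume "\<not> 1 \<le> k"
    then have "k = 0" by simp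
    then have "B = {}" if "B \<in> \<B>" for B using cardB[OF that] finB[OF that] by simp
    then have "\<B> = {{}}" using ne by blast
    moreover have "{B. B \<subseteq> E \<and> card B = 0} = {{}}"
      using finite_subset[OF _ E] by (auto simp: card_eq_0_iff)
    ultimately show False using nu unfolding uniform_def by metis
  qed
  show "card E - k \<le> card C" if C: "transversal E \<B> C" for C
  proof -
    obtain C' where C': "C' \<subseteq> C" "transversal E \<B> C'" "\<And>X. X \<subset> C' \<Longrightarrow> \<not> transversal E \<B> X"
      using minimal_transversal_exists[OF E C] by blast
    have CE: "C \<subseteq> E" "C' \<subseteq> E" using C C'(1) unfolding transversal_def by auto
    have "circuit E (dual_bases E \<B>) C'"
      unfolding circuit_def
    proof (intro conjI allI impI)
      show "indep (dual_bases E \<B>) X" if "X \<subset> C'" for X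
        using indep_dual_iff[of X E \<B>] C'(3)[OF that] that CE(2) by auto
      show "\<not> indep (dual_bases E \<B>) C'" using indep_dual_iff[OF CE(2)] C'(2) by blast
    qed (rule CE(2))
    then have "matroid_rank (dual_bases E \<B>) \<le> card C'" using pav unfolding paving_def by blast
    also have "\<dots> \<le> card C" by (rule card_mono[OF finite_subset[OF CE(1) E] C'(1)])
    finally have "matroid_rank (dual_bases E \<B>) \<le> card C" .
    moreover obtain B where B: "B \<in> \<B>" using ne by blast
    then have "E - B \<in> dual_bases E \<B>" unfolding dual_bases_def by blast
    then have "matroid_rank (dual_bases E \<B>) = card (E - B)" using card_basis[OF M'] by metis
    moreover have "card (E - B) = card E - k"
      using card_Diff_subset[OF finB[OF B] subB[OF B]] cardB[OF B] by simp
    ultimately show ?thesis by simp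
  qed
qed

text \<open>The number \<tau>. As an infimum it needs no proof of attainment; covers that come close
  to it suffice below.\<close>

definition frac_cover_number :: "'e set \<Rightarrow> 'e set set \<Rightarrow> real" where
  "frac_cover_number E \<B> = Inf {sum y E |y. frac_cover E \<B> y}"

definition symbolic_exps :: "'e set \<Rightarrow> 'e set set \<Rightarrow> nat \<Rightarrow> ('e \<Rightarrow>\<^sub>0 nat) set" where
  "symbolic_exps E \<B> s = {m \<in> exponents E. \<forall>C. transversal E \<B> C \<longrightarrow> s \<le> weight C m}"

lemma initial_degree_least:
  fixes U :: "('e \<Rightarrow>\<^sub>0 nat) set"
  assumes "finite E" "U \<subseteq> exponents E" "m \<in> U"
  shows "initial_degree (monomial_span U :: ('e, 'k::field) mpoly set) \<le> weight E m"
  unfolding initial_degree_monomial_span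
  by (rule Least_le) (use assms exp_degree_weight[OF assms(1)] in blast)

lemma initial_degree_attained:
  fixes U :: "('e \<Rightarrow>\<^sub>0 nat) set"
  assumes "finite E" "U \<subseteq> exponents E" "U \<noteq> {}"
  obtains m where "m \<in> U" "initial_degree (monomial_span U :: ('e, 'k::field) mpoly set) = weight E m"
proof -
  have "\<exists>d. \<exists>m\<in>U. exp_degree m = d" using assms(3) by blast
  from LeastI_ex[OF this] obtain m where "m \<in> U"
    "exp_degree m = initial_degree (monomial_span U :: ('e, 'k) mpoly set)"
    unfolding initial_degree_monomial_span by blast
  then show ?thesis using that[of m] exp_degree_weight[OF assms(1), of m] assms(2) by auto
qed

context dual_paving
begin

section \<open>The Waldschmidt constant as a fractional cover number\<close>

lemma bases_Pow: "\<B> \<subseteq> Pow E"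
  using sub by blast

lemma transversal_ground: "transversal E \<B> E"
  unfolding transversal_def
proof (intro conjI ballI)
  fix B assume B: "B \<in> \<B>"
  then have "B \<noteq> {}" using cardB[OF B] kpos by auto
  then show "E \<inter> B \<noteq> {}" using sub[OF B] by blast
qed simp

lemma frac_cover_sum_ge_1: "frac_cover E \<B> y \<Longrightarrow> 1 \<le> sum y E"
  using transversal_ground unfolding frac_cover_def by blast

lemma frac_cover_number_le:
  assumes "frac_cover E \<B> y"
  shows "frac_cover_number E \<B> \<le> sum y E"
  unfolding frac_cover_number_def
proof (rule cInf_lower)
  show "bdd_below {sum y E |y. frac_cover E \<B> y}"
    using frac_cover_sum_ge_1 by (intro bdd_belowI[of _ 1]) auto
qed (use assms in blast)

lemma frac_cover_number_approx:
  assumes "frac_cover_number E \<B> < u"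
  obtains y where "frac_cover E \<B> y" "sum y E < u"
proof -
  have "{sum y E |y. frac_cover E \<B> y} \<noteq> {}" using frac_cover_const by blast
  from cInf_lessD[OF this] assms show ?thesis
    using that unfolding frac_cover_number_def by blast
qed

lemma frac_cover_number_ge_1: "1 \<le> frac_cover_number E \<B>"
proof (rule ccontr)
  assume "\<not> ?thesis"
  then obtain y where "frac_cover E \<B> y" "sum y E < 1"
    using frac_cover_number_approx[of 1] by auto
  then show False using frac_cover_sum_ge_1[of y] by simp
qed

lemma frac_cover_of_symbolic_exp:
  assumes m: "m \<in> symbolic_exps E \<B> s" and s: "0 < s"
  shows "frac_cover E \<B> (\<lambda>e. real (Poly_Mapping.lookup m e) / real s)"
proof -
  have "1 \<le> (\<Sum>e\<in>C. real (Poly_Mapping.lookup m e) / real s)" if C: "transversal E \<B> C" for C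
  proof -
    have "s \<le> weight C m" using m C unfolding symbolic_exps_def by blast
    then have "1 \<le> real (weight C m) / real s" using s by simp
    then show ?thesis by (simp add: weight_def sum_divide_distrib)
  qed
  then show ?thesis unfolding frac_cover_def by simp
qed

text \<open>Rounding \<open>s y\<close> up keeps all transversal conditions and costs at most 1 per
  element, an error that does not grow with \<open>s\<close>.\<close>

lemma symbolic_exp_of_frac_cover:
  assumes y: "frac_cover E \<B> y"
  obtains m where "m \<in> symbolic_exps E \<B> s" "real (weight E m) \<le> real s * sum y E + real (card E)"
proof -
  define m where "m = (\<Sum>e\<in>E. Poly_Mapping.single e (nat \<lceil>real s * y e\<rceil>))"
  have look: "Poly_Mapping.lookup m e = (if e \<in> E then nat \<lceil>real s * y e\<rceil> else 0)" for e
  proof -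
    have "Poly_Mapping.lookup m e = (\<Sum>i\<in>E. if i = e then nat \<lceil>real s * y e\<rceil> else 0)"
      unfolding m_def lookup_sum by (intro sum.cong) (auto simp: lookup_single when_def)
    then show ?thesis using finE by simp
  qed
  have y0: "0 \<le> y e" if "e \<in> E" for e using y that unfolding frac_cover_def by blast
  have lower: "real s * y e \<le> real (Poly_Mapping.lookup m e)" if "e \<in> E" for e
    using that unfolding look by (simp add: real_nat_ceiling_ge)
  have upper: "real (Poly_Mapping.lookup m e) \<le> real s * y e + 1" if "e \<in> E" for e
    using that y0[OF that] unfolding look by simp
  have "s \<le> weight C m" if C: "transversal E \<B> C" for C
  proof -
    have "real s * 1 \<le> real s * sum y C" using y C unfolding frac_cover_def by (intro mult_left_mono) auto
    also have "\<dots> = (\<Sum>e\<in>C. real s * y e)" by (rule sum_distrib_left)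
    also have "\<dots> \<le> (\<Sum>e\<in>C. real (Poly_Mapping.lookup m e))"
      by (intro sum_mono lower) (use transversal_subset[OF C] in blast)
    finally show ?thesis unfolding weight_def by (metis mult.right_neutral of_nat_le_iff of_nat_sum)
  qed
  moreover have "m \<in> exponents E" unfolding exponents_def by (auto simp: in_keys_iff look split: if_splits)
  ultimately have "m \<in> symbolic_exps E \<B> s" unfolding symbolic_exps_def by blast
  moreover have "real (weight E m) \<le> (\<Sum>e\<in>E. real s * y e + 1)"
    unfolding weight_def of_nat_sum by (rule sum_mono) (rule upper)
  then have "real (weight E m) \<le> real s * sum y E + real (card E)"
    by (simp add: sum.distrib sum_distrib_left)
  ultimately show ?thesis by (rule that)
qed

lemma symbolic_exp_weight_ge:
  assumes "m \<in> symbolic_exps E \<B> s" "0 < s"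
  shows "real s * frac_cover_number E \<B> \<le> real (weight E m)"
proof -
  have "frac_cover_number E \<B> \<le> (\<Sum>e\<in>E. real (Poly_Mapping.lookup m e) / real s)"
    by (rule frac_cover_number_le[OF frac_cover_of_symbolic_exp[OF assms]])
  also have "\<dots> = real (weight E m) / real s" by (simp add: weight_def sum_divide_distrib)
  finally show ?thesis using assms(2) by (simp add: field_simps)
qed

lemma symbolic_power_eq:
  "symbolic_power (mpoly_ring E) (facet_ideal TYPE('k::field) E \<B>) s = monomial_span (symbolic_exps E \<B> s)"
  unfolding symbolic_exps_def by (rule symbolic_power_facet_ideal[OF finE bases_Pow])

text \<open>Dividing exponents by \<open>s\<close> gives covers, so \<tau> is a lower bound for
  every positive \<open>s\<close>; rounding a nearly optimal cover exceeds its sum by at most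
  \<open>card E / s\<close>, which tends to 0.\<close>

lemma waldschmidt_eq_frac_cover_number:
  "waldschmidt (mpoly_ring E) (facet_ideal TYPE('k::field) E \<B>) = frac_cover_number E \<B>"
proof -
  define a where "a s = initial_degree (monomial_span (symbolic_exps E \<B> s) :: ('e, 'k) mpoly set)" for s
  have sub_exps: "symbolic_exps E \<B> s \<subseteq> exponents E" for s unfolding symbolic_exps_def by blast
  have lower: "frac_cover_number E \<B> \<le> real (a s) / real s" if s: "0 < s" for s
  proof -
    have "symbolic_exps E \<B> s \<noteq> {}" using symbolic_exp_of_frac_cover[OF frac_cover_const] by blast
    then obtain m where "m \<in> symbolic_exps E \<B> s" "a s = weight E m"
      using initial_degree_attained[OF finE sub_exps] unfolding a_def by metis
    then show ?thesis using symbolic_exp_weight_ge[of m s] s by (simp add: field_simps)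
  qed
  have upper: "real (a s) / real s \<le> sum y E + real (card E) / real s"
    if y: "frac_cover E \<B> y" and s: "0 < s" for y s
  proof -
    obtain m where m: "m \<in> symbolic_exps E \<B> s" "real (weight E m) \<le> real s * sum y E + real (card E)"
      using symbolic_exp_of_frac_cover[OF y] by blast
    have "a s \<le> weight E m" unfolding a_def by (rule initial_degree_least[OF finE sub_exps m(1)])
    then show ?thesis using m(2) s by (simp add: field_simps)
  qed
  have "(\<lambda>s. real (a s) / real s) \<longlonglongrightarrow> frac_cover_number E \<B>"
  proof (rule order_tendstoI)
    fix l assume l: "l < frac_cover_number E \<B>"
    show "\<forall>\<^sub>F s in sequentially. l < real (a s) / real s"
      using eventually_gt_at_top[of 0]
    proof eventually_elim
      case (elim s)
      show ?case using lower[OF elim] l by linarith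
    qed
  next
    fix u assume "frac_cover_number E \<B> < u"
    then obtain y where y: "frac_cover E \<B> y" "sum y E < u" using frac_cover_number_approx by blast
    have "(\<lambda>s. sum y E + real (card E) / real s) \<longlonglongrightarrow> sum y E + 0"
      by (intro tendsto_add tendsto_const lim_const_over_n)
    then have "\<forall>\<^sub>F s in sequentially. sum y E + real (card E) / real s < u"
      using y(2) by (intro order_tendstoD(2)) auto
    then show "\<forall>\<^sub>F s in sequentially. real (a s) / real s < u"
      using eventually_gt_at_top[of 0]
    proof eventually_elim
      case (elim s)
      show ?case using upper[OF y(1) elim(2)] elim(1) by linarith
    qed
  qed
  then have "lim (\<lambda>s. real (a s) / real s) = frac_cover_number E \<B>" by (rule limI)
  then show ?thesis unfolding waldschmidt_def symbolic_power_eq a_def .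
qed

lemma initial_degree_facet_ideal: "initial_degree (facet_ideal TYPE('k::field) E \<B>) = k"
proof -
  let ?U = "{m \<in> exponents E. \<exists>B\<in>\<B>. \<forall>e\<in>B. 1 \<le> Poly_Mapping.lookup m e}"
  have eq: "facet_ideal TYPE('k) E \<B> = monomial_span ?U" by (rule facet_ideal_eq[OF finE bases_Pow])
  have U: "?U \<subseteq> exponents E" by blast
  obtain B where B: "B \<in> \<B>" using ne by blast
  have fB: "finite B" by (rule finite_ground_subset[OF sub[OF B]])
  have ind: "indicator_exp B \<in> ?U"
    using B sub[OF B] by (auto simp: exponents_def in_keys_iff lookup_indicator_exp[OF fB]
        intro!: bexI[of _ B] split: if_splits)
  have "weight E (indicator_exp B) = card (E \<inter> B)"
    unfolding weight_def lookup_indicator_exp[OF fB] using finE by (simp add: sum.If_cases)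
  then have wk: "weight E (indicator_exp B) = k" using sub[OF B] cardB[OF B] by (simp add: Int_absorb1)
  have le: "initial_degree (monomial_span ?U :: ('e, 'k) mpoly set) \<le> k"
    using initial_degree_least[OF finE U ind] unfolding wk .
  obtain m where m: "m \<in> ?U" "initial_degree (monomial_span ?U :: ('e, 'k) mpoly set) = weight E m"
    by (rule initial_degree_attained[OF finE U]) (use ind in blast)+
  then obtain B' where B': "B' \<in> \<B>" "\<forall>e\<in>B'. 1 \<le> Poly_Mapping.lookup m e" by blast
  have "card B' * 1 \<le> weight B' m"
    unfolding weight_def using sum_bounded_below[of B' 1 "Poly_Mapping.lookup m"] B'(2) by simp
  also have "\<dots> \<le> weight E m" by (rule weight_mono[OF finE sub[OF B'(1)]])
  finally show ?thesis using le m(2) cardB[OF B'(1)] unfolding eq by simp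
qed

section \<open>Containments between symbolic and ordinary powers\<close>

lemma symbolic_exp_basis_bound:
  assumes m: "m \<in> symbolic_exps E \<B> s" and s: "0 < s" and A: "A \<subseteq> E"
  shows "\<exists>B\<in>\<B>. real (card (A \<inter> B)) * (real s * frac_cover_number E \<B>) \<le> real k * real (weight A m)"
proof -
  obtain B y where B: "B \<in> \<B>" and y: "frac_cover E \<B> y"
    "real (card (A \<inter> B)) * sum y E \<le> real k * (\<Sum>e\<in>A. real (Poly_Mapping.lookup m e) / real s)"
    using frac_cover_compare[OF frac_cover_of_symbolic_exp[OF m s] A] by blast
  have "real (card (A \<inter> B)) * frac_cover_number E \<B> \<le> real (card (A \<inter> B)) * sum y E"
    by (rule mult_left_mono[OF frac_cover_number_le[OF y(1)]]) simp
  also have "\<dots> \<le> real k * real (weight A m) / real s"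
    using y(2) by (simp add: weight_def flip: sum_divide_distrib)
  finally have "real (card (A \<inter> B)) * (real s * frac_cover_number E \<B>) \<le> real k * real (weight A m)"
    using s by (simp add: field_simps)
  then show ?thesis using B by blast
qed

text \<open>For a suitable basis \<open>B\<close>, multiplying the hypothesis \<open>r\<close> by
  \<open>card (A \<inter> B)\<close> and applying \<open>symbolic_exp_basis_bound\<close> leaves a
  common factor \<open>k\<close>; cancelling it gives the hypothesis of
  \<open>base_packing\<close>.\<close>

lemma symbolic_power_subset_power:
  assumes M: "matroid E \<B>" and s: "0 < s" and r: "real r * real k \<le> real s * frac_cover_number E \<B>"
  shows "symbolic_power (mpoly_ring E) (facet_ideal TYPE('k::field) E \<B>) s
    \<subseteq> ideal_power (mpoly_ring E) (facet_ideal TYPE('k) E \<B>) r"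
  unfolding symbolic_power_eq ideal_power_facet_ideal[OF finE bases_Pow]
proof (rule monomial_span_mono, rule subsetI)
  fix m assume m: "m \<in> symbolic_exps E \<B> s"
  have "\<exists>B\<in>\<B>. r * card (A \<inter> B) \<le> (\<Sum>e\<in>A. Poly_Mapping.lookup m e)" if A: "A \<subseteq> E" for A
  proof -
    obtain B where B: "B \<in> \<B>"
      "real (card (A \<inter> B)) * (real s * frac_cover_number E \<B>) \<le> real k * real (weight A m)"
      using symbolic_exp_basis_bound[OF m s A] by blast
    have "real (card (A \<inter> B)) * (real r * real k) \<le> real (card (A \<inter> B)) * (real s * frac_cover_number E \<B>)"
      by (rule mult_left_mono[OF r]) simp
    then have "real k * real (r * card (A \<inter> B)) \<le> real k * real (weight A m)"
      using B(2) by (simp add: mult_ac)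
    then have "r * card (A \<inter> B) \<le> weight A m" using kpos by (simp flip: of_nat_mult)
    then show ?thesis using B(1) unfolding weight_def by blast
  qed
  from base_packing[OF M this]
  show "m \<in> {m \<in> exponents E. \<exists>\<beta>. (\<forall>i<r. \<beta> i \<in> \<B>) \<and>
      (\<forall>e\<in>E. card {i. i < r \<and> e \<in> \<beta> i} \<le> Poly_Mapping.lookup m e)}"
    using m unfolding symbolic_exps_def by blast
qed

text \<open>Double counting of the pairs \<open>(i, e)\<close> with \<open>e\<close> in the
  \<open>i\<close>-th basis. This is the packing condition for \<open>A = E\<close>, which obstructs
  the containments.\<close>

lemma weight_ge_if_bases:
  assumes "\<forall>i<N. \<beta> i \<in> \<B>" "\<forall>e\<in>E. card {i. i < N \<and> e \<in> \<beta> i} \<le> Poly_Mapping.lookup m e"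
  shows "N * k \<le> weight E m"
proof -
  have "N * k = (\<Sum>i<N. card (\<beta> i))" using assms(1) cardB by simp
  also have "\<dots> = (\<Sum>i<N. \<Sum>e\<in>E. if e \<in> \<beta> i then 1 else 0)"
  proof (intro sum.cong refl)
    fix i assume "i \<in> {..<N}"
    then have "\<beta> i \<subseteq> E" using assms(1) sub by auto
    then show "card (\<beta> i) = (\<Sum>e\<in>E. if e \<in> \<beta> i then 1 else 0)"
      using finE by (simp add: sum.If_cases Int_absorb1)
  qed
  also have "\<dots> = (\<Sum>e\<in>E. \<Sum>i<N. if e \<in> \<beta> i then 1 else 0)" by (rule sum.swap)
  also have "\<dots> = (\<Sum>e\<in>E. card {i. i < N \<and> e \<in> \<beta> i})"
    by (simp add: sum.If_cases Int_def)
  also have "\<dots> \<le> weight E m" unfolding weight_def by (rule sum_mono) (use assms(2) in blast)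
  finally show ?thesis .
qed

text \<open>Take a cover \<open>y\<close> with \<open>s y(E) < r k\<close>. The rounded multiple of
  \<open>y\<close> has degree at most \<open>s t y(E) + card E\<close>; its distance below
  \<open>r t k\<close> grows linearly in \<open>t\<close> with slope \<delta>, so it eventually
  outweighs the fixed rounding error.\<close>

lemma eventually_symbolic_power_not_subset:
  assumes s: "0 < s" and r: "real s * frac_cover_number E \<B> < real r * real k"
  shows "\<forall>\<^sub>F t in sequentially. \<not> symbolic_power (mpoly_ring E) (facet_ideal TYPE('k::field) E \<B>) (s * t)
    \<subseteq> ideal_power (mpoly_ring E) (facet_ideal TYPE('k) E \<B>) (r * t)"
proof -
  have "frac_cover_number E \<B> < real r * real k / real s" using r s by (simp add: field_simps)
  then obtain y where y: "frac_cover E \<B> y" "sum y E < real r * real k / real s"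
    using frac_cover_number_approx by blast
  define \<delta> where "\<delta> = real r * real k - real s * sum y E"
  have \<delta>: "0 < \<delta>" unfolding \<delta>_def using y(2) s by (simp add: field_simps)
  have "\<forall>\<^sub>F t in sequentially. real (card E) / \<delta> < real t"
    using filterlim_real_sequentially by (simp add: filterlim_at_top_dense)
  then show ?thesis
  proof eventually_elim
    case (elim t)
    then have t: "real (card E) < \<delta> * real t" using \<delta> by (simp add: field_simps)
    obtain m where m: "m \<in> symbolic_exps E \<B> (s * t)"
      "real (weight E m) \<le> real (s * t) * sum y E + real (card E)"
      using symbolic_exp_of_frac_cover[OF y(1)] by blast
    have "real (weight E m) < real (r * t * k)"
      using m(2) t unfolding \<delta>_def by (simp add: algebra_simps)
    then have less: "weight E m < r * t * k" by linarith
    show ?case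
      unfolding symbolic_power_eq ideal_power_facet_ideal[OF finE bases_Pow] monomial_span_subset_iff
    proof
      assume "symbolic_exps E \<B> (s * t) \<subseteq> {m \<in> exponents E. \<exists>\<beta>. (\<forall>i<r * t. \<beta> i \<in> \<B>) \<and>
        (\<forall>e\<in>E. card {i. i < r * t \<and> e \<in> \<beta> i} \<le> Poly_Mapping.lookup m e)}"
      then obtain \<beta> where "\<forall>i<r * t. \<beta> i \<in> \<B>"
        "\<forall>e\<in>E. card {i. i < r * t \<and> e \<in> \<beta> i} \<le> Poly_Mapping.lookup m e" using m(1) by blast
      from weight_ge_if_bases[OF this] less show False by simp
    qed
  qed
qed

proposition asymptotic_resurgence_facet_ideal:
  assumes M: "matroid E \<B>"
  shows "asymptotic_resurgence (mpoly_ring E) (facet_ideal TYPE('k::field) E \<B>)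
    = ereal (real k / frac_cover_number E \<B>)"
proof -
  let ?\<tau> = "frac_cover_number E \<B>"
  let ?bad = "\<lambda>s r. \<forall>\<^sub>F t in sequentially. \<not> symbolic_power (mpoly_ring E) (facet_ideal TYPE('k) E \<B>) (s * t)
    \<subseteq> ideal_power (mpoly_ring E) (facet_ideal TYPE('k) E \<B>) (r * t)"
  let ?R = "{ereal (real s / real r) |s r. 0 < s \<and> 0 < r \<and> ?bad s r}"
  have \<tau>: "0 < ?\<tau>" using frac_cover_number_ge_1 by simp
  have "Sup ?R = ereal (real k / ?\<tau>)"
  proof (rule antisym)
    show "Sup ?R \<le> ereal (real k / ?\<tau>)"
    proof (rule Sup_least, clarify)
      fix s r :: nat assume sr: "0 < s" "0 < r" and bad: "?bad s r"
      have "real s / real r \<le> real k / ?\<tau>"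
      proof (rule ccontr)
        assume "\<not> ?thesis"
        then have le: "real r * real k \<le> real s * ?\<tau>" using sr \<tau> by (simp add: field_simps)
        \<comment> \<open>One positive \<open>t\<close> from the eventual statement is enough,
          because the assumed inequality scales to \<open>s t\<close> and
          \<open>r t\<close>.\<close>
        obtain t where t: "0 < t" "\<not> symbolic_power (mpoly_ring E) (facet_ideal TYPE('k) E \<B>) (s * t)
          \<subseteq> ideal_power (mpoly_ring E) (facet_ideal TYPE('k) E \<B>) (r * t)"
          using eventually_happens[OF eventually_conj[OF eventually_gt_at_top[of 0] bad]] by auto
        have "real (r * t) * real k \<le> real (s * t) * ?\<tau>"
          using mult_left_mono[OF le, of "real t"] by (simp add: mult_ac)
        moreover have "0 < s * t" using t(1) sr(1) by simp
        ultimately show False using symbolic_power_subset_power[OF M] t(2) by blast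
      qed
      then show "ereal (real s / real r) \<le> ereal (real k / ?\<tau>)" by simp
    qed
    show "ereal (real k / ?\<tau>) \<le> Sup ?R"
    proof (rule dense_le)
      fix z assume "z < ereal (real k / ?\<tau>)"
      then obtain x where x: "z < ereal x" "x < real k / ?\<tau>" using ereal_dense2 by force
      \<comment> \<open>The bound \<open>z\<close> may be negative or minus infinity; passing to
        \<open>max 0 x\<close> makes the rational \<open>q\<close> positive, so that it is a
        quotient of positive naturals.\<close>
      have "max 0 x < real k / ?\<tau>" using x(2) \<tau> kpos by simp
      then obtain q where q: "q \<in> \<rat>" "max 0 x < q" "q < real k / ?\<tau>" using Rats_dense_in_real by blast
      obtain s r :: nat where sr: "r \<noteq> 0" "\<bar>q\<bar> = real s / real r" using Rats_abs_nat_div_natE[OF q(1)] by metis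
      then have qeq: "q = real s / real r" using q(2) by simp
      then have "0 < s" "0 < r" using q(2) sr(1) by (auto intro: Nat.gr0I)
      moreover have "real s * ?\<tau> < real r * real k"
        using q(3) \<tau> sr(1) unfolding qeq by (simp add: field_simps)
      ultimately have "ereal q \<in> ?R" using eventually_symbolic_power_not_subset qeq by blast
      then have "ereal q \<le> Sup ?R" by (rule Sup_upper)
      moreover have "z \<le> ereal q" using x(1) q(2) by (metis ereal_less_eq(3) less_imp_le max.strict_boundedE order_trans)
      ultimately show "z \<le> Sup ?R" by (rule order_trans[rotated])
    qed
  qed
  then show ?thesis unfolding asymptotic_resurgence_def .
qed

end

theorem theorem5p13:
  fixes E :: "'e set" and \<B> :: "'e set set" and n k :: nat
  defines "S \<equiv> (mpoly_ring E :: ('e, 'k::field) mpoly ring)"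
  defines "I \<equiv> facet_ideal TYPE('k) E \<B>"
  assumes "matroid E \<B>"
    and "card E = n"
    and "matroid_rank \<B> = k"
    and "\<not> uniform E \<B>"
    and "paving E (dual_bases E \<B>)"
    and "n \<ge> 2 * k"
  shows "asymptotic_resurgence S I = ereal (real (initial_degree I) / waldschmidt S I)
       \<and> real (initial_degree I) / waldschmidt S I = real k / waldschmidt S I"
proof -
  interpret dual_paving E \<B> "card E - k" k
    by (rule dual_paving_if_matroid) (use assms in simp_all)
  show ?thesis
    unfolding S_def I_def waldschmidt_eq_frac_cover_number initial_degree_facet_ideal
    using asymptotic_resurgence_facet_ideal[OF assms(3)] by simp
qed

end
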